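(* Let $A\in\mathbb{R}^{n\times n}$ be stable and let $C\in\mathbb{R}^{m\times n}$ be such that $(A,C)$ is observable. Let $P_\#$ be the unique positive definite solution of $A^\top P+PA+C^\top C=0$ (which exists under these hypotheses). Then there exist $\alpha>0$ and constants $k,\lambda>0$ such that every solution $P(t)$ of $$\dot P=A^\top P+PA+\alpha\,\mathrm{tr}(P)\,C^\top C,\qquad P(0)=P_0\in\mathbb{S}_+^n\setminus\{0\},$$ satisfies $$d_{\mathcal H}(P(t),P_\#)\le k\,e^{-\lambda t}\,d_{\mathcal H}(P_0,P_\#)\qquad\text{for all }t\ge0.$$
   Context: $\mathbb{S}_+^n$ is the cone of real symmetric positive semidefinite $n\times n$ matrices, and $X\preceq Y$ means $Y-X\in\mathbb{S}_+^n$. $A$ is stable if all its eigenvalues have negative real part. The pair $(A,C)$ is observable if the stacked matrix $\mathrm{col}(C,CA,\dots,CA^{n-1})$ has full (column) rank $n$. For $X,Y\in\mathbb{S}_+^n\setminus\{0\}$ let $M(X/Y)=\inf\{\lambda: X\preceq\lambda Y\}$ and $m(X/Y)=\sup\{\mu:\mu Y\preceq X\}$. The Hilbert metric is $d_{\mathcal H}(X,Y)=\ln\frac{M(X/Y)}{m(X/Y)}\in[0,\infty]$, with value $+\infty$ if $M(X/Y)=\infty$ or $m(X/Y)=0$. *)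

theory Defs
  imports "HOL-Analysis.Analysis"
begin

definition psd_cone :: "(real^'n^'n) set" where
  "psd_cone = {X. transpose X = X \<and> (\<forall>x. 0 \<le> x \<bullet> (X *v x))}"

definition positive_definite :: "real^'n^'n \<Rightarrow> bool" where
  "positive_definite X \<longleftrightarrow> transpose X = X \<and> (\<forall>x. x \<noteq> 0 \<longrightarrow> 0 < x \<bullet> (X *v x))"

definition loewner_le :: "real^'n^'n \<Rightarrow> real^'n^'n \<Rightarrow> bool"  (infix "\<preceq>" 50) where
  "X \<preceq> Y \<longleftrightarrow> Y - X \<in> psd_cone"

definition complex_matrix :: "real^'n^'m \<Rightarrow> complex^'n^'m" where
  "complex_matrix A = (\<chi> i j. complex_of_real (A $ i $ j))"

definition is_eigenvalue :: "complex^'n^'n \<Rightarrow> complex \<Rightarrow> bool" where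
  "is_eigenvalue A \<mu> \<longleftrightarrow> (\<exists>v. v \<noteq> 0 \<and> A *v v = \<mu> *s v)"

definition stable_matrix :: "real^'n^'n \<Rightarrow> bool" where
  "stable_matrix A \<longleftrightarrow> (\<forall>\<mu>. is_eigenvalue (complex_matrix A) \<mu> \<longrightarrow> Re \<mu> < 0)"

primrec matrix_pow :: "real^'n^'n \<Rightarrow> nat \<Rightarrow> real^'n^'n" where
  "matrix_pow A 0 = mat 1"
| "matrix_pow A (Suc k) = A ** matrix_pow A k"

(* The row indexed by (b, i) is row i of C A^k, where k is the number of b under a fixed
   bijection from the index type 'n onto {0, ..., n - 1}. So each of the blocks
   C, C A, ..., C A^(n-1) occurs exactly once; the choice of bijection only permutes blocks. *)
definition observability_matrix :: "real^'n^'n \<Rightarrow> real^'n^'m \<Rightarrow> real^'n^('n \<times> 'm)" where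
  "observability_matrix A C =
     (\<chi> r. (C ** matrix_pow A (to_nat_on (UNIV :: 'n set) (fst r))) $ snd r)"

definition observable :: "real^'n^'n \<Rightarrow> real^'n^'m \<Rightarrow> bool" where
  "observable A C \<longleftrightarrow> rank (observability_matrix A C) = CARD('n)"

(* Infimum and supremum are over real scalars, taken in the extended reals (empty infimum = \<infinity>). *)
definition hilbert_M :: "real^'n^'n \<Rightarrow> real^'n^'n \<Rightarrow> ereal" where
  "hilbert_M X Y = Inf {ereal \<mu> |\<mu>. X \<preceq> \<mu> *\<^sub>R Y}"

definition hilbert_m :: "real^'n^'n \<Rightarrow> real^'n^'n \<Rightarrow> ereal" where
  "hilbert_m X Y = Sup {ereal \<mu> |\<mu>. \<mu> *\<^sub>R Y \<preceq> X}"

(* Meaningful only for X, Y in psd_cone - {0}; there M(X/Y) > 0 and 0 \<le> m(X/Y) < \<infinity>. *)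
definition hilbert_metric :: "real^'n^'n \<Rightarrow> real^'n^'n \<Rightarrow> ereal" where
  "hilbert_metric X Y =
     (if hilbert_M X Y = \<infinity> \<or> hilbert_m X Y = 0 then \<infinity>
      else ereal (ln (real_of_ereal (hilbert_M X Y) / real_of_ereal (hilbert_m X Y))))"

definition lyapunov_eq :: "real^'n^'n \<Rightarrow> real^'n^'m \<Rightarrow> real^'n^'n \<Rightarrow> bool" where
  "lyapunov_eq A C P \<longleftrightarrow> transpose A ** P + P ** A + transpose C ** C = 0"

definition flow_solution ::
    "real^'n^'n \<Rightarrow> real^'n^'m \<Rightarrow> real \<Rightarrow> (real \<Rightarrow> real^'n^'n) \<Rightarrow> bool" where
  "flow_solution A C \<alpha> P \<longleftrightarrow>
     (\<forall>t\<ge>0. (P has_vector_derivative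
        (transpose A ** P t + P t ** A + (\<alpha> * trace (P t)) *\<^sub>R (transpose C ** C)))
        (at t within {0..}))"

end

theory Submission
  imports Defs "HOL-Computational_Algebra.Fundamental_Theorem_Algebra"
begin

text \<open>
  With \<open>\<alpha> = 1 / tr(Ps)\<close> the Lyapunov solution \<open>Ps\<close> is an equilibrium of a linear flow that preserves
  the cone: along \<open>u(s) = exp(A (t - s)) x\<close> the form \<open>u(s) \<bullet> P(s) u(s)\<close> has derivative
  \<open>\<alpha> tr(P(s)) |C u(s)|\<^sup>2\<close>, and positivity of the trace propagates by a first-time argument.
  Observability makes \<open>Ps - exp(A)\<^sup>T Ps exp(A)\<close> positive definite, so the time-one map is strongly
  positive, \<open>P(1) \<succeq> c tr(P(0)) Ps\<close>. Applying this to \<open>P - a Ps\<close> and \<open>b Ps - P\<close> shrinks the interval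
  \<open>[a, b]\<close> with \<open>a Ps \<preceq> P \<preceq> b Ps\<close> by the factor \<open>1 - c tr(Ps)\<close> per unit of time, Birkhoff's contraction
  in elementary form.
\<close>

section \<open>The matrix exponential\<close>

text \<open>All dynamics is reduced to scalar functions of time obtained by testing on fixed
  vectors. The trajectory \<open>u(s)\<close> runs backwards so that its motion cancels
  \<open>A^T P + P A\<close> and only the output term survives. The obstacle is the feedback factor
  \<open>\<alpha> tr(P)\<close>: it involves all of \<open>P\<close>, so forms are controlled by
  past traces while the trace is itself a sum of forms. Since the feedback is linear in
  \<open>P\<close>, the two gaps between \<open>P\<close> and its order bounds \<open>a Ps\<close>,
  \<open>b Ps\<close> evolve by the same equation. Their traces add up to
  \<open>(b - a) tr(Ps)\<close>, which is why the shrinking factor does not depend on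
  \<open>P\<close>. Stability is given only through the spectrum. Decay of \<open>exp(tA)\<close> is
  therefore derived from an annihilating polynomial; it makes the Lyapunov operator injective and
  forces the form of \<open>Ps\<close> to be nonnegative.\<close>

lemma bounded_bilinear_matrix_vector_mult:
  "bounded_bilinear ((*v) :: real^'n^'m \<Rightarrow> real^'n \<Rightarrow> real^'m)"
  unfolding bilinear_conv_bounded_bilinear[symmetric] bilinear_def
  by (auto intro!: linearI simp: algebra_simps matrix_vector_mult_scaleR scaleR_matrix_vector_assoc)

lemma has_vector_derivative_matrix:
  fixes F :: "real \<Rightarrow> real^'n^'m"
  assumes "\<And>i j. ((\<lambda>t. F t $ i $ j) has_real_derivative D $ i $ j) (at t within S)"
  shows "(F has_vector_derivative D) (at t within S)"
proof -
  have "((\<lambda>t. F t \<bullet> b) has_derivative (\<lambda>h. (h *\<^sub>R D) \<bullet> b)) (at t within S)" if "b \<in> Basis" for b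
  proof -
    obtain i j where b: "b = axis i (axis j 1)"
      using \<open>b \<in> Basis\<close> by (auto simp: Basis_vec_def)
    show ?thesis
      using assms[of i j]
      by (simp add: b inner_axis has_field_derivative_def mult.commute mult_commute_abs)
  qed
  then show ?thesis
    unfolding has_vector_derivative_def
    by (subst has_derivative_componentwise_within) auto
qed

lemma matrix_pow_commute: "A ** matrix_pow A k = matrix_pow A k ** A"
  by (induction k) (simp_all, metis matrix_mul_assoc)

text \<open>This is \<open>exp(tA)\<close>. Each entry is written as a real power series in
  \<open>t\<close>, so that termwise differentiation of scalar series applies.\<close>

definition mexp :: "real^'n^'n \<Rightarrow> real \<Rightarrow> real^'n^'n" where
  "mexp A t = (\<chi> i j. \<Sum>k. matrix_pow A k $ i $ j / fact k * t ^ k)"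

lemma matrix_pow_entry_bound:
  "\<bar>matrix_pow A k $ i $ j\<bar> \<le> (\<Sum>i\<in>UNIV. \<Sum>l\<in>UNIV. \<bar>A $ i $ l\<bar>) ^ k"
proof (induction k arbitrary: i j)
  case 0
  then show ?case by (simp add: mat_def)
next
  case (Suc k)
  let ?B = "\<Sum>i\<in>UNIV. \<Sum>l\<in>UNIV. \<bar>A $ i $ l\<bar>"
  have "\<bar>matrix_pow A (Suc k) $ i $ j\<bar> \<le> (\<Sum>l\<in>UNIV. \<bar>A $ i $ l * matrix_pow A k $ l $ j\<bar>)"
    by (simp add: matrix_matrix_mult_def)
  also have "\<dots> \<le> (\<Sum>l\<in>UNIV. \<bar>A $ i $ l\<bar> * ?B ^ k)"
    unfolding abs_mult by (intro sum_mono mult_left_mono Suc.IH) auto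
  also have "\<dots> = (\<Sum>l\<in>UNIV. \<bar>A $ i $ l\<bar>) * ?B ^ k"
    by (simp add: sum_distrib_right)
  also have "\<dots> \<le> ?B * ?B ^ k"
    by (intro mult_right_mono member_le_sum[of i UNIV "\<lambda>i. \<Sum>l\<in>UNIV. \<bar>A $ i $ l\<bar>"])
       (auto intro!: sum_nonneg zero_le_power)
  finally show ?case by simp
qed

lemma mexp_entry_summable:
  "summable (\<lambda>k. matrix_pow A k $ i $ j / fact k * (t::real) ^ k)"
proof -
  define B where "B = (\<Sum>i\<in>UNIV. \<Sum>l\<in>UNIV. \<bar>A $ i $ l\<bar>)"
  show ?thesis
  proof (rule summable_comparison_test')
    show "summable (\<lambda>k. inverse (fact k) * (B * \<bar>t\<bar>) ^ k)"
      by (rule summable_exp)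
    show "norm (matrix_pow A k $ i $ j / fact k * t ^ k) \<le> inverse (fact k) * (B * \<bar>t\<bar>) ^ k" for k
      using mult_right_mono[OF matrix_pow_entry_bound[of A k i j], of "\<bar>t\<bar> ^ k"]
      by (simp add: B_def abs_mult power_abs power_mult_distrib field_simps)
  qed
qed

lemma mexp_has_vector_derivative:
  "(mexp A has_vector_derivative A ** mexp A t) (at t)"
proof (rule has_vector_derivative_matrix)
  fix i j
  let ?c = "\<lambda>l k. matrix_pow A k $ l $ j / fact k"
  have "((\<lambda>t. mexp A t $ i $ j) has_real_derivative (\<Sum>k. diffs (?c i) k * t ^ k)) (at t)"
    unfolding mexp_def
    using termdiffs_strong_converges_everywhere[of "?c i" t] mexp_entry_summable[of A i j] by simp
  also have "(\<Sum>k. diffs (?c i) k * t ^ k) = (\<Sum>k. \<Sum>l\<in>UNIV. A $ i $ l * (?c l k * t ^ k))"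
  proof (intro arg_cong[of _ _ suminf] ext)
    fix k
    \<comment> \<open>\<open>diffs\<close> multiplies coefficient \<open>k + 1\<close> by
      \<open>k + 1\<close>; this factor reduces \<open>fact (Suc k)\<close> to \<open>fact k\<close>
      and leaves one extra factor \<open>A\<close>.\<close>
    have "diffs (?c i) k = (A ** matrix_pow A k) $ i $ j / fact k"
      unfolding diffs_def
      by (simp add: fact_Suc del: of_nat_Suc of_nat_add)
    then show "diffs (?c i) k * t ^ k = (\<Sum>l\<in>UNIV. A $ i $ l * (?c l k * t ^ k))"
      by (simp add: matrix_matrix_mult_def sum_divide_distrib sum_distrib_left sum_distrib_right mult_ac)
  qed
  also have "\<dots> = (\<Sum>l\<in>UNIV. \<Sum>k. A $ i $ l * (?c l k * t ^ k))"
    by (intro suminf_sum summable_mult mexp_entry_summable)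
  also have "\<dots> = (A ** mexp A t) $ i $ j"
    unfolding matrix_matrix_mult_def mexp_def vec_lambda_beta
    by (intro sum.cong refl suminf_mult mexp_entry_summable)
  finally show "((\<lambda>t. mexp A t $ i $ j) has_real_derivative (A ** mexp A t) $ i $ j) (at t)" .
qed

lemma mexp_0 [simp]: "mexp A 0 = mat 1" for A :: "real^'n^'n"
proof -
  have "(\<Sum>k. matrix_pow A k $ i $ j / fact k * 0 ^ k) = (mat 1 :: real^'n^'n) $ i $ j"
    for i j
    using powser_zero[of "\<lambda>k. matrix_pow A k $ i $ j / fact k"] by simp
  then show ?thesis by (simp add: mexp_def vec_eq_iff)
qed

lemma mexp_apply_has_vector_derivative:
  "((\<lambda>t. mexp A t *v x) has_vector_derivative A *v (mexp A t *v x)) (at t within S)"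
  using bounded_linear.has_vector_derivative[OF
      bounded_bilinear.bounded_linear_left[OF bounded_bilinear_matrix_vector_mult]
      mexp_has_vector_derivative[THEN has_vector_derivative_at_within]]
  by (simp add: matrix_vector_mul_assoc)

lemma mexp_apply_reverse_has_vector_derivative:
  "((\<lambda>s. mexp A (t - s) *v x) has_vector_derivative - (A *v (mexp A (t - s) *v x))) (at s within S)"
proof -
  have "((\<lambda>s. t - s) has_real_derivative -1) (at s within S)"
    by (auto intro!: derivative_eq_intros)
  from vector_diff_chain_within[OF this[unfolded has_real_derivative_iff_has_vector_derivative] mexp_apply_has_vector_derivative]
  show ?thesis by (simp add: o_def)
qed

section \<open>Quadratic forms along trajectories and scalar differential inequalities\<close>

lemma inner_transpose_mult: "x \<bullet> (transpose A *v y) = (A *v x) \<bullet> (y :: real^'m)"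
  for A :: "real^'n^'m"
  by (metis dot_lmul_matrix inner_commute transpose_matrix_vector)

lemma quadratic_has_real_derivative:
  fixes X :: "real \<Rightarrow> real^'n^'m"
  assumes "(x has_vector_derivative x') (at t within S)"
    and "(X has_vector_derivative X') (at t within S)"
    and "(y has_vector_derivative y') (at t within S)"
  shows "((\<lambda>t. x t \<bullet> (X t *v y t)) has_real_derivative
    x' \<bullet> (X t *v y t) + x t \<bullet> (X' *v y t) + x t \<bullet> (X t *v y')) (at t within S)"
proof -
  have "((\<lambda>t. X t *v y t) has_vector_derivative X t *v y' + X' *v y t) (at t within S)"
    by (rule bounded_bilinear.has_vector_derivative[OF bounded_bilinear_matrix_vector_mult assms(2,3)])
  from bounded_bilinear.has_vector_derivative[OF bounded_bilinear_inner assms(1) this]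
  show ?thesis
    by (simp add: has_real_derivative_iff_has_vector_derivative inner_add_right algebra_simps)
qed

text \<open>The arguments move with velocity \<open>- A u\<close>, which cancels
  \<open>transpose A ** P + P ** A\<close> exactly. Two vectors are allowed because the symmetry and
  injectivity arguments need the whole bilinear form; there \<open>c = 0\<close> and the form is
  constant.\<close>

lemma congruence_has_real_derivative:
  fixes A :: "real^'n^'n" and C :: "real^'n^'m"
  assumes "(P has_vector_derivative
      transpose A ** P s + P s ** A + c *\<^sub>R (transpose C ** C)) (at s within S)"
  shows "((\<lambda>s. (mexp A (t - s) *v x) \<bullet> (P s *v (mexp A (t - s) *v y))) has_real_derivative
    c * ((C *v (mexp A (t - s) *v x)) \<bullet> (C *v (mexp A (t - s) *v y)))) (at s within S)"
proof -
  define u v where "u = mexp A (t - s) *v x" and "v = mexp A (t - s) *v y"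
  have "- (A *v u) \<bullet> (P s *v v)
      + u \<bullet> ((transpose A ** P s + P s ** A + c *\<^sub>R (transpose C ** C)) *v v)
      + u \<bullet> (P s *v - (A *v v)) = c * ((C *v u) \<bullet> (C *v v))"
    by (simp add: matrix_vector_mult_add_rdistrib inner_add_right inner_transpose_mult
        scaleR_matrix_vector_assoc[symmetric] vec.neg del: transpose_matrix_vector flip: matrix_vector_mul_assoc)
  then show ?thesis
    using quadratic_has_real_derivative[where x = "\<lambda>s. mexp A (t - s) *v x" and
        y = "\<lambda>s. mexp A (t - s) *v y", OF mexp_apply_reverse_has_vector_derivative assms
        mexp_apply_reverse_has_vector_derivative]
    unfolding u_def v_def by simp
qed

lemma mono_of_nonneg_derivative:
  fixes f :: "real \<Rightarrow> real"
  assumes "a \<le> b"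
    and "\<And>s. s \<in> {a..b} \<Longrightarrow> (f has_real_derivative f' s) (at s within {a..b})"
    and "\<And>s. s \<in> {a<..<b} \<Longrightarrow> 0 \<le> f' s"
  shows "f a \<le> f b"
proof (cases "a = b")
  case False
  then have "a < b" using assms(1) by simp
  from mvt_simple[OF this, of f "\<lambda>s h. f' s * h"] assms(2)
  obtain s where "s \<in> {a<..<b}" "f b - f a = f' s * (b - a)"
    by (auto simp: has_field_derivative_def)
  then show ?thesis using assms(3)[of s] \<open>a < b\<close>
    by (metis diff_ge_0_iff_ge less_eq_real_def mult_nonneg_nonneg)
qed simp

text \<open>A Gronwall inequality from below: the integrating factor \<open>exp (K * s)\<close>
  turns the hypothesis into monotonicity. No sign of \<open>f\<close> is assumed, so it also applies
  to differences such as \<open>e / 2 - f\<close>.\<close>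

lemma exp_decay_lower_bound:
  fixes f :: "real \<Rightarrow> real"
  assumes "a \<le> b"
    and d: "\<And>s. s \<in> {a..b} \<Longrightarrow> (f has_real_derivative f' s) (at s within {a..b})"
    and "\<And>s. s \<in> {a..b} \<Longrightarrow> - K * f s \<le> f' s"
  shows "f a * exp (- K * (b - a)) \<le> f b"
proof -
  have "f a * exp (K * a) \<le> f b * exp (K * b)"
  proof (rule mono_of_nonneg_derivative[OF assms(1)])
    show "((\<lambda>s. f s * exp (K * s)) has_real_derivative (f' s + K * f s) * exp (K * s))
        (at s within {a..b})" if "s \<in> {a..b}" for s
      using d[OF that] by (auto intro!: derivative_eq_intros simp: algebra_simps)
    show "0 \<le> (f' s + K * f s) * exp (K * s)" if "s \<in> {a<..<b}" for s
      using assms(3)[of s] that by auto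
  qed
  then have "f a * exp (K * a) * exp (- K * b) \<le> f b * exp (K * b) * exp (- K * b)"
    by (intro mult_right_mono) auto
  then show ?thesis
    by (simp add: algebra_simps exp_minus exp_diff divide_inverse)
qed

text \<open>The squared norm of \<open>exp(sA) x\<close> has logarithmic rate at least
  \<open>- 2 K\<close>, where \<open>K\<close> bounds \<open>A\<close>, so a nonzero vector cannot
  reach 0 in finite time.\<close>

lemma mexp_apply_eq_0_iff:
  assumes "0 \<le> t" "mexp A t *v x = 0"
  shows "x = 0"
proof -
  obtain K where K: "K > 0" "\<And>z. norm (A *v z) \<le> norm z * K"
    using bounded_linear.pos_bounded[OF matrix_vector_mul_bounded_linear[of A]] by blast
  define f where "f = (\<lambda>s. (mexp A s *v x) \<bullet> (mexp A s *v x))"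
  have "f 0 * exp (- (2 * K) * (t - 0)) \<le> f t"
  proof (rule exp_decay_lower_bound[OF assms(1)])
    show "(f has_real_derivative 2 * ((mexp A s *v x) \<bullet> (A *v (mexp A s *v x)))) (at s within {0..t})" for s
      using bounded_bilinear.has_vector_derivative[OF bounded_bilinear_inner
          mexp_apply_has_vector_derivative mexp_apply_has_vector_derivative]
      unfolding f_def has_real_derivative_iff_has_vector_derivative
      by (rule has_vector_derivative_eq_rhs) (simp add: inner_commute)
    fix s
    have "\<bar>(mexp A s *v x) \<bullet> (A *v (mexp A s *v x))\<bar> \<le> norm (mexp A s *v x) * (norm (mexp A s *v x) * K)"
      by (rule order_trans[OF Cauchy_Schwarz_ineq2 mult_left_mono[OF K(2)]]) simp
    then show "- (2 * K) * f s \<le> 2 * ((mexp A s *v x) \<bullet> (A *v (mexp A s *v x)))"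
      by (simp add: f_def dot_square_norm power2_eq_square algebra_simps)
  qed
  with assms(2) show "x = 0" by (simp add: f_def mult_le_0_iff flip: power2_norm_eq_inner)
qed

section \<open>Stability implies decay\<close>

text \<open>The vector \<open>p(B) v\<close> in Horner form, so that proofs follow the
  \<open>pCons\<close> recursion.\<close>

definition poly_act :: "complex^'n^'n \<Rightarrow> complex poly \<Rightarrow> complex^'n \<Rightarrow> complex^'n" where
  "poly_act B p = fold_coeffs (\<lambda>a f v. a *s v + B *v f v) p (\<lambda>v. 0)"

lemma poly_act_0 [simp]: "poly_act B 0 v = 0"
  by (simp add: poly_act_def)

lemma poly_act_pCons [simp]: "poly_act B (pCons a p) v = a *s v + B *v poly_act B p v"
  by (cases "p = 0"; cases "a = 0")
     (auto simp: poly_act_def fold_coeffs_pCons_eq fold_coeffs_pCons_not_0_0_eq fun_eq_iff)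

lemma poly_act_add: "poly_act B (p + q) v = poly_act B p v + poly_act B q v"
  by (induction p q rule: poly_induct2)
     (simp_all add: matrix_vector_right_distrib vec.scale_left_distrib algebra_simps)

lemma poly_act_smult: "poly_act B (smult c p) v = c *s poly_act B p v"
  by (induction p) (simp_all add: vec.scale_right_distrib vec.scale)

lemma poly_act_sum: "poly_act B (\<Sum>k\<in>K. p k) v = (\<Sum>k\<in>K. poly_act B (p k) v)"
  by (induction K rule: infinite_finite_induct) (simp_all add: poly_act_add)

lemma poly_act_commute:
  "poly_act B p (B *v v - \<mu> *s v) = B *v poly_act B p v - \<mu> *s poly_act B p v"
proof (induction p)
  case (pCons a p)
  show ?case
    unfolding poly_act_pCons pCons.IH
    by (simp add: vec.scale_right_distrib vec.scale vec.diff vec.add vec.scale_right_diff_distrib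
        mult.commute)
qed simp

lemma poly_act_linear_factor:
  "poly_act B ([:- \<mu>, 1:] * p) v = B *v poly_act B p v - \<mu> *s poly_act B p v"
proof -
  have "[:- \<mu>, 1:] * p = smult (- \<mu>) p + pCons 0 p" by simp
  then show ?thesis by (simp only: poly_act_add poly_act_smult poly_act_pCons) simp
qed

lemma complex_matrix_mult: "complex_matrix (X ** Y) = complex_matrix X ** complex_matrix Y"
  by (simp add: complex_matrix_def matrix_matrix_mult_def vec_eq_iff)

lemma poly_act_monom:
  "poly_act (complex_matrix A) (monom 1 k) v = complex_matrix (matrix_pow A k) *v v"
proof (induction k)
  case 0
  have "complex_matrix (matrix_pow A 0) = mat 1"
    by (simp add: complex_matrix_def mat_def vec_eq_iff)
  then show ?case by (simp add: monom_0 del: matrix_pow.simps)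
qed (simp add: monom_Suc complex_matrix_mult matrix_vector_mul_assoc)

text \<open>Linear dependence is a property of sets, and a repeated value disappears in the image of
  \<open>f\<close>. Repetitions are therefore treated separately, with the relation
  \<open>f i - f j = 0\<close>.\<close>

lemma sequence_linear_relation:
  fixes f :: "nat \<Rightarrow> 'a::euclidean_space"
  obtains c where "\<exists>k\<le>DIM('a). c k \<noteq> 0" "(\<Sum>k\<le>DIM('a). c k *\<^sub>R f k) = 0"
proof (cases "inj_on f {..DIM('a)}")
  case True
  then have "card (f ` {..DIM('a)}) > DIM('a)"
    by (simp add: card_image)
  then have "dependent (f ` {..DIM('a)})"
    using independent_bound by (metis not_le)
  then obtain u where "\<exists>v\<in>f ` {..DIM('a)}. u v \<noteq> 0" "(\<Sum>v\<in>f ` {..DIM('a)}. u v *\<^sub>R v) = 0"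
    by (auto simp: dependent_finite)
  then show ?thesis
    by (intro that[of "u \<circ> f"]) (auto simp: sum.reindex[OF True])
next
  case False
  then obtain i j where ij: "i \<le> DIM('a)" "j \<le> DIM('a)" "i \<noteq> j" "f i = f j"
    by (auto simp: inj_on_def)
  define c :: "nat \<Rightarrow> real" where "c = (\<lambda>k. of_bool (k = i) - of_bool (k = j))"
  have "(\<Sum>k\<le>DIM('a). c k *\<^sub>R f k)
      = (\<Sum>k\<le>DIM('a). of_bool (k = i) *\<^sub>R f k) - (\<Sum>k\<le>DIM('a). of_bool (k = j) *\<^sub>R f k)"
    by (simp add: c_def scaleR_diff_left sum_subtractf)
  also have "\<dots> = 0"
    using ij by (simp add: of_bool_def if_distrib[of "\<lambda>r. r *\<^sub>R _"] cong: if_cong)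
  finally show ?thesis
    using ij by (intro that[of c]) (auto simp: c_def)
qed

text \<open>The powers of \<open>A\<close> up to the dimension of the matrix space are linearly
  dependent. This stands in for Cayley-Hamilton: any nonzero annihilator will do. Its coefficients
  are cast to complex numbers so that it can be split into linear factors.\<close>

lemma annihilating_polynomial:
  fixes A :: "real^'n^'n"
  obtains q where "q \<noteq> 0" "\<And>v. poly_act (complex_matrix A) q v = 0"
proof -
  let ?N = "DIM(real^'n^'n)"
  obtain c where c: "\<exists>k\<le>?N. c k \<noteq> 0" "(\<Sum>k\<le>?N. c k *\<^sub>R matrix_pow A k) = 0"
    by (rule sequence_linear_relation[of "matrix_pow A"])
  define q where "q = (\<Sum>k\<le>?N. smult (complex_of_real (c k)) (monom 1 k))"
  have "coeff q k = of_real (c k)" if "k \<le> ?N" for k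
    using that by (simp add: q_def coeff_sum if_distrib cong: if_cong)
  then have "q \<noteq> 0" using c(1) by (metis coeff_0 of_real_eq_0_iff)
  moreover have "poly_act (complex_matrix A) q v = 0" for v
  proof -
    have "poly_act (complex_matrix A) q v $ i = 0" for i
    proof -
      have "poly_act (complex_matrix A) q v $ i
          = (\<Sum>k\<le>?N. \<Sum>j\<in>UNIV. of_real (c k) * (of_real (matrix_pow A k $ i $ j) * v $ j))"
        unfolding q_def poly_act_sum poly_act_smult poly_act_monom
        by (simp add: complex_matrix_def matrix_vector_mult_def sum_distrib_left)
      also have "\<dots> = (\<Sum>j\<in>UNIV. of_real ((\<Sum>k\<le>?N. c k *\<^sub>R matrix_pow A k) $ i $ j) * v $ j)"
        by (subst sum.swap) (simp add: sum_distrib_right mult.assoc)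
      also have "\<dots> = 0" by (simp only: c(2)) simp
      finally show ?thesis .
    qed
    then show ?thesis by (simp add: vec_eq_iff)
  qed
  ultimately show ?thesis using that by blast
qed

text \<open>Once \<open>g\<close> stays below \<open>a * e / 2\<close>, the function
  \<open>e / 2 - f\<close> obeys the lower Gronwall bound, so \<open>f\<close> exceeds
  \<open>e / 2\<close> by at most a decaying exponential.\<close>

lemma tendsto_0_of_damped_inequality:
  fixes f :: "real \<Rightarrow> real"
  assumes "a > 0" and nonneg: "\<And>t. 0 \<le> f t"
    and d: "\<And>t. (f has_real_derivative f' t) (at t)"
    and le: "\<And>t. f' t \<le> - a * f t + g t"
    and g: "(g \<longlongrightarrow> 0) at_top"
  shows "(f \<longlongrightarrow> 0) at_top"
proof (rule tendstoI)
  fix e :: real assume "e > 0"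
  then have "\<forall>\<^sub>F t in at_top. g t < a * e / 2"
    using g \<open>a > 0\<close> by (intro order_tendstoD(2)[OF g]) simp
  then obtain T where T: "\<And>t. t \<ge> T \<Longrightarrow> g t \<le> a * e / 2"
    by (metis (mono_tags, lifting) eventually_at_top_linorder less_le)
  have "((\<lambda>t. (f T - e / 2) * exp (- a * (t - T))) \<longlongrightarrow> 0) at_top"
  proof (rule tendsto_mult_right_zero)
    have "filterlim (\<lambda>t. a * (- T + t)) at_top at_top"
      using \<open>a > 0\<close>
      by (intro filterlim_tendsto_pos_mult_at_top[OF tendsto_const]
          filterlim_tendsto_add_at_top[OF tendsto_const] filterlim_ident)
    then have "filterlim (\<lambda>t. - a * (t - T)) at_bot at_top"
      by (simp add: filterlim_uminus_at_top algebra_simps)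
    then show "((\<lambda>t. exp (- a * (t - T))) \<longlongrightarrow> 0) at_top"
      by (rule filterlim_compose[OF exp_at_bot])
  qed
  then have "\<forall>\<^sub>F t in at_top. (f T - e / 2) * exp (- a * (t - T)) < e / 2"
    using \<open>e > 0\<close> by (intro order_tendstoD(2)) auto
  then show "\<forall>\<^sub>F t in at_top. dist (f t) 0 < e"
    using eventually_ge_at_top[of T]
  proof eventually_elim
    case (elim t)
    have "(e / 2 - f T) * exp (- a * (t - T)) \<le> e / 2 - f t"
    proof (rule exp_decay_lower_bound[OF elim(2)])
      show "((\<lambda>t. e / 2 - f t) has_real_derivative - f' s) (at s within {T..t})" for s
        using DERIV_subset[OF d[of s]] by (auto intro!: derivative_eq_intros)
      show "- a * (e / 2 - f s) \<le> - f' s" if "s \<in> {T..t}" for s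
        using le[of s] T[of s] that by (simp add: algebra_simps)
    qed
    with elim(1) nonneg[of t] show ?case by (simp add: algebra_simps)
  qed
qed

lemma inner_complex_scale: "u \<bullet> (\<mu> *s u) = Re \<mu> * (u \<bullet> u)" for u :: "complex^'n"
  by (simp add: inner_vec_def inner_complex_def sum_distrib_left algebra_simps)

text \<open>Peel off one root \<open>\<mu>\<close> of the annihilating polynomial at a time: \<open>B u - \<mu> u\<close> solves the same
  equation with a smaller polynomial, and drives \<open>u\<close> through a damped scalar equation.\<close>

lemma linear_ode_tendsto_0:
  fixes B :: "complex^'n^'n"
  assumes stable: "\<And>\<mu>. is_eigenvalue B \<mu> \<Longrightarrow> Re \<mu> < 0"
  shows "q \<noteq> 0 \<Longrightarrow> (\<And>t. poly_act B q (u t) = 0) \<Longrightarrow>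
    (\<And>t. (u has_vector_derivative B *v u t) (at t)) \<Longrightarrow> (u \<longlongrightarrow> 0) at_top"
proof (induction "degree q" arbitrary: q u)
  case 0
  then obtain c where "q = [:c:]" "c \<noteq> 0"
    by (metis degree_eq_zeroE pCons_0_0)
  then have "u = (\<lambda>t. 0)" using 0(3) by (auto simp: vec.scale_eq_0_iff)
  then show ?case by simp
next
  case (Suc n)
  obtain \<mu> where "poly q \<mu> = 0"
    using fundamental_theorem_of_algebra[of q] Suc.hyps(2) by (auto simp: constant_degree)
  then obtain r where q: "q = [:- \<mu>, 1:] * r"
    by (auto simp: poly_eq_0_iff_dvd)
  with \<open>q \<noteq> 0\<close> have "r \<noteq> 0" by auto
  then have "degree q = Suc (degree r)"
    unfolding q by (subst degree_mult_eq) auto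
  then have n: "n = degree r" using Suc.hyps(2) by simp
  note IH = Suc.hyps(1)[OF n \<open>r \<noteq> 0\<close>]
  show ?case
  proof (cases "is_eigenvalue B \<mu>")
    \<comment> \<open>The annihilator may have roots that are not eigenvalues, and nothing is known
      about their real parts. For such a root \<open>B - \<mu>\<close> is injective, so the smaller
      polynomial already annihilates \<open>u\<close>.\<close>
    case False
    have "B *v poly_act B r (u t) = \<mu> *s poly_act B r (u t)" for t
      using Suc.prems(2)[of t] unfolding q poly_act_linear_factor by simp
    with False have "poly_act B r (u t) = 0" for t
      unfolding is_eigenvalue_def by blast
    then show ?thesis using IH Suc.prems(3) by blast
  next
    case True
    define a where "a = - Re \<mu>"
    have "a > 0" using stable[OF True] by (simp add: a_def)
    define z where "z = (\<lambda>t. B *v u t - \<mu> *s u t)"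
    have lin: "linear (\<lambda>v. B *v v - \<mu> *s v)"
      by (intro linearI)
        (auto simp: algebra_simps vec.scale_right_distrib vec_eq_iff linear_scale[OF matrix_vector_mul_linear] scaleR_right_diff_distrib)
    have "(z has_vector_derivative B *v z t) (at t)" for t
    proof -
      have "(z has_vector_derivative B *v (B *v u t) - \<mu> *s (B *v u t)) (at t)"
        using bounded_linear.has_vector_derivative[OF lin[unfolded linear_conv_bounded_linear]
            Suc.prems(3)] unfolding z_def .
      then show ?thesis by (simp add: z_def vec.diff vec.scale)
    qed
    moreover have "poly_act B r (z t) = 0" for t
      using Suc.prems(2)[of t] unfolding q poly_act_linear_factor z_def poly_act_commute .
    ultimately have z0: "(z \<longlongrightarrow> 0) at_top" using IH by blast
    have "((\<lambda>t. u t \<bullet> u t) \<longlongrightarrow> 0) at_top"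
    proof (rule tendsto_0_of_damped_inequality[OF \<open>a > 0\<close>])
      show "((\<lambda>t. u t \<bullet> u t) has_real_derivative 2 * (u t \<bullet> (B *v u t))) (at t)" for t
        using bounded_bilinear.has_vector_derivative[OF bounded_bilinear_inner
            Suc.prems(3) Suc.prems(3)] unfolding has_real_derivative_iff_has_vector_derivative
        by (rule has_vector_derivative_eq_rhs) (simp add: inner_commute)
      show "2 * (u t \<bullet> (B *v u t)) \<le> - a * (u t \<bullet> u t) + (z t \<bullet> z t) / a" for t
      proof -
        have "B *v u t = \<mu> *s u t + z t" by (simp add: z_def)
        then have "u t \<bullet> (B *v u t) = - a * (u t \<bullet> u t) + u t \<bullet> z t"
          by (simp add: inner_add_right inner_complex_scale a_def)
        \<comment> \<open>Young's inequality, obtained from a square: it spends half of the damping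
          \<open>2 * a\<close> to absorb the cross term \<open>u t \<bullet> z t\<close>.\<close>
        moreover have "0 \<le> (a *\<^sub>R u t - z t) \<bullet> (a *\<^sub>R u t - z t) / a"
          using \<open>a > 0\<close> by simp
        then have "2 * (u t \<bullet> z t) \<le> a * (u t \<bullet> u t) + (z t \<bullet> z t) / a"
          using \<open>a > 0\<close> by (simp add: inner_diff_left inner_diff_right inner_commute field_simps)
        ultimately show ?thesis by (simp add: algebra_simps)
      qed
      show "((\<lambda>t. z t \<bullet> z t / a) \<longlongrightarrow> 0) at_top"
        using tendsto_divide[OF tendsto_inner[OF z0 z0] tendsto_const, of a] \<open>a > 0\<close> by simp
    qed simp
    then have "((\<lambda>t. sqrt (u t \<bullet> u t)) \<longlongrightarrow> sqrt 0) at_top"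
      by (rule tendsto_real_sqrt)
    then show ?thesis
      by (simp add: tendsto_norm_zero_iff flip: norm_eq_sqrt_inner)
  qed
qed

lemma mexp_tendsto_0:
  fixes A :: "real^'n^'n"
  assumes "stable_matrix A"
  shows "((\<lambda>t. mexp A t *v x) \<longlongrightarrow> 0) at_top"
proof -
  define cv :: "real^'n \<Rightarrow> complex^'n" where "cv = (\<lambda>x. \<chi> i. of_real (x $ i))"
  have "linear cv" by (intro linearI) (simp_all add: cv_def vec_eq_iff, simp add: scaleR_conv_of_real)
  then have blin: "bounded_linear cv" by (simp add: linear_conv_bounded_linear)
  have cvA: "cv (A *v y) = complex_matrix A *v cv y" for y
    by (simp add: cv_def complex_matrix_def matrix_vector_mult_def vec_eq_iff)
  obtain q where q: "q \<noteq> 0" "\<And>v. poly_act (complex_matrix A) q v = 0"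
    using annihilating_polynomial[of A] by blast
  have "((\<lambda>t. cv (mexp A t *v x)) \<longlongrightarrow> 0) at_top"
    using linear_ode_tendsto_0[OF _ q] assms
      bounded_linear.has_vector_derivative[OF blin mexp_apply_has_vector_derivative[of A x _ UNIV]]
    unfolding stable_matrix_def cvA by blast
  then have "((\<lambda>t. Re (cv (mexp A t *v x) $ i)) \<longlongrightarrow> 0) at_top" for i
    using tendsto_Re[OF tendsto_vec_nth[of _ 0, of _ _ i]] by fastforce
  then show ?thesis
    by (intro vec_tendstoI) (simp add: cv_def)
qed

section \<open>The Lyapunov equation\<close>

lemma linear_transpose: "linear (transpose :: real^'n^'m \<Rightarrow> real^'m^'n)"
  by (intro linearI) (simp_all add: transpose_def vec_eq_iff)

lemma linear_matrix_mult_left: "linear (\<lambda>X :: real^'p^'n. (A :: real^'n^'m) ** X)"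
  by (intro linearI) (simp_all add: matrix_add_ldistrib matrix_scalar_ac scalar_matrix_assoc)

lemma linear_matrix_mult_right: "linear (\<lambda>X :: real^'n^'m. X ** (A :: real^'p^'n))"
  by (intro linearI)
     (simp_all add: matrix_matrix_mult_def vec_eq_iff sum.distrib distrib_right sum_distrib_left mult.assoc)

lemma observable_imp_eq_0:
  assumes "observable A C" "\<And>k. C *v (matrix_pow A k *v x) = 0"
  shows "x = 0"
proof -
  have "observability_matrix A C *v x = 0"
  proof (subst vec_eq_iff, intro allI)
    fix r
    have "(observability_matrix A C *v x) $ r
        = (C *v (matrix_pow A (to_nat_on UNIV (fst r)) *v x)) $ snd r"
      by (simp add: observability_matrix_def matrix_vector_mul_component matrix_vector_mul_assoc)
    then show "(observability_matrix A C *v x) $ r = 0 $ r" by (simp add: assms(2))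
  qed
  moreover have "inj ((*v) (observability_matrix A C))"
    using assms(1) by (simp add: observable_def full_rank_injective)
  ultimately show ?thesis
    by (metis injD matrix_vector_mult_0_right)
qed

lemma constant_congruence:
  fixes A :: "real^'n^'n" and C :: "real^'n^'m"
  assumes "transpose A ** P + P ** A + c *\<^sub>R (transpose C ** C) = 0"
  shows "((\<lambda>s. (mexp A (t - s) *v x) \<bullet> (P *v (mexp A (t - s) *v y))) has_real_derivative
    c * ((C *v (mexp A (t - s) *v x)) \<bullet> (C *v (mexp A (t - s) *v y)))) (at s within S)"
  using assms by (intro congruence_has_real_derivative) simp

lemma lyapunov_form_mono:
  assumes "lyapunov_eq A C P" "a \<le> b" "b \<le> t"
  shows "(mexp A (t - a) *v x) \<bullet> (P *v (mexp A (t - a) *v x))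
    \<le> (mexp A (t - b) *v x) \<bullet> (P *v (mexp A (t - b) *v x))"
  by (rule mono_of_nonneg_derivative[OF assms(2)
        constant_congruence[where c = 1 and C = C]])
     (use assms(1) in \<open>auto simp: lyapunov_eq_def\<close>)

text \<open>Without a drop, the form is constant along the trajectory, so \<open>C exp(sA) x\<close>
  vanishes on the open unit interval. Repeated differentiation gives
  \<open>C A^k exp(sA) x = 0\<close> for all \<open>k\<close>, and observability yields
  \<open>exp(sA) x = 0\<close>. Working in the interior, finally at \<open>1 / 2\<close>, gives
  two-sided derivatives.\<close>

lemma lyapunov_form_strict_decrease:
  fixes A :: "real^'n^'n" and C :: "real^'n^'m"
  assumes obs: "observable A C" and lyap: "lyapunov_eq A C P" and "x \<noteq> 0"
  shows "(mexp A 1 *v x) \<bullet> (P *v (mexp A 1 *v x)) < x \<bullet> (P *v x)"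
proof (rule ccontr)
  define g where "g = (\<lambda>s. (mexp A (1 - s) *v x) \<bullet> (P *v (mexp A (1 - s) *v x)))"
  assume "\<not> ?thesis"
  then have g10: "g 1 \<le> g 0" by (simp add: g_def)
  have mono: "g a \<le> g b" if "a \<le> b" "b \<le> 1" for a b
    unfolding g_def using lyapunov_form_mono[OF lyap that] .
  have const: "g s = g 0" if "s \<in> {0<..<1}" for s
    using mono[of 0 s] mono[of s 1] g10 that by simp
  have CE: "C *v (mexp A (1 - s) *v x) = 0" if s: "s \<in> {0<..<1}" for s
  proof -
    have "(g has_real_derivative
        1 * ((C *v (mexp A (1 - s) *v x)) \<bullet> (C *v (mexp A (1 - s) *v x)))) (at s)"
      unfolding g_def using lyap by (intro constant_congruence) (simp add: lyapunov_eq_def)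
    moreover have "(g has_real_derivative 0) (at s)"
      by (rule has_field_derivative_transform_within_open[OF DERIV_const[of "g 0"], where S = "{0<..<1}"])
         (use s const in auto)
    ultimately show ?thesis using DERIV_unique by force
  qed
  have CAE: "C *v (matrix_pow A k *v (mexp A s *v x)) = 0" if "s \<in> {0<..<1}" for k s
    using that
  proof (induction k arbitrary: s)
    case 0
    then show ?case using CE[of "1 - s"] by simp
  next
    case (Suc k)
    let ?h = "\<lambda>s. C *v (matrix_pow A k *v (mexp A s *v x))"
    have "bounded_linear (\<lambda>y. C *v (matrix_pow A k *v y))"
      using matrix_vector_mul_bounded_linear[of "C ** matrix_pow A k"] by (simp add: matrix_vector_mul_assoc)
    from bounded_linear.has_vector_derivative[OF this mexp_apply_has_vector_derivative]
    have "(?h has_vector_derivative C *v (matrix_pow A k *v (A *v (mexp A s *v x)))) (at s)" .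
    moreover have "(?h has_vector_derivative 0) (at s)"
      by (rule has_vector_derivative_transform_within_open[OF has_vector_derivative_const[of 0], where S = "{0<..<1}"])
         (use Suc in auto)
    ultimately have "C *v (matrix_pow A k *v (A *v (mexp A s *v x))) = 0"
      by (rule vector_derivative_unique_at)
    moreover have "matrix_pow A (Suc k) *v y = matrix_pow A k *v (A *v y)" for y
      by (simp add: matrix_pow_commute matrix_vector_mul_assoc)
    ultimately show ?case by simp
  qed
  have "mexp A (1 / 2) *v x = 0"
    by (rule observable_imp_eq_0[OF obs CAE]) auto
  with \<open>x \<noteq> 0\<close> show False
    using mexp_apply_eq_0_iff[of "1 / 2" A x] by simp
qed

lemma mexp_form_tendsto_0:
  assumes "stable_matrix A"
  shows "((\<lambda>t. (mexp A t *v x) \<bullet> (P *v (mexp A t *v y))) \<longlongrightarrow> 0) at_top"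
  using tendsto_inner[OF mexp_tendsto_0[OF assms] bounded_linear.tendsto[OF
      matrix_vector_mul_bounded_linear mexp_tendsto_0[OF assms]], of x P y] by simp

text \<open>For a homogeneous solution the bilinear form is constant along \<open>exp(tA)\<close>,
  while stability sends it to 0.\<close>

lemma lyapunov_operator_injective:
  assumes "stable_matrix A" and "transpose A ** P + P ** A = 0"
  shows "P = 0"
proof -
  have "x \<bullet> (P *v y) = 0" for x y
  proof -
    have const: "(mexp A t *v x) \<bullet> (P *v (mexp A t *v y)) = x \<bullet> (P *v y)" if "t \<ge> 0" for t
    proof -
      have "((\<lambda>s. (mexp A (t - s) *v x) \<bullet> (P *v (mexp A (t - s) *v y))) has_real_derivative 0)
          (at s)" for s
        using constant_congruence[of A P 0 "0 :: real^'a^'a"] assms(2) by simp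
      from DERIV_isconst_all[OF allI[OF this], of 0 t] show ?thesis by simp
    qed
    have "((\<lambda>t::real. x \<bullet> (P *v y)) \<longlongrightarrow> 0) at_top"
      by (rule Lim_transform_eventually[OF mexp_form_tendsto_0[OF assms(1), of x P y]])
         (rule eventually_mono[OF eventually_ge_at_top[of 0] const])
    then show ?thesis by (simp add: tendsto_const_iff)
  qed
  then have "P *v y = 0" for y by (metis inner_eq_zero_iff)
  then show ?thesis by (metis matrix_eq matrix_vector_mult_0)
qed

text \<open>Existence comes from uniqueness: an injective endomorphism of a finite-dimensional space
  is onto. The transpose solves the same equation, hence symmetry. The form does not increase along
  \<open>exp(tA)\<close> and tends to 0, hence is nonnegative; its strict drop over unit time makes
  it positive.\<close>

lemma lyapunov_solution:
  fixes A :: "real^'n^'n" and C :: "real^'n^'m"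
  assumes stab: "stable_matrix A" and obs: "observable A C"
  shows "\<exists>!P. lyapunov_eq A C P" "lyapunov_eq A C P \<Longrightarrow> positive_definite P"
proof -
  define L where "L = (\<lambda>P. transpose A ** P + P ** A)"
  have "linear L"
    unfolding L_def
    by (intro linear_compose_add linear_matrix_mult_left linear_matrix_mult_right)
  moreover have "inj L"
    unfolding linear_injective_0[OF \<open>linear L\<close>]
    using lyapunov_operator_injective[OF stab] unfolding L_def by blast
  ultimately have bij: "bij L"
    by (simp add: bij_def linear_injective_imp_surjective)
  have iff: "lyapunov_eq A C P \<longleftrightarrow> L P = - (transpose C ** C)" for P
    unfolding lyapunov_eq_def L_def by (rule eq_neg_iff_add_eq_0[symmetric])
  show ex1: "\<exists>!P. lyapunov_eq A C P"
    unfolding iff using bij unfolding bij_iff by blast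
  show "positive_definite P" if P: "lyapunov_eq A C P"
  proof -
    have "transpose (transpose A ** P + P ** A + transpose C ** C) = transpose 0"
      using P by (simp add: lyapunov_eq_def)
    then have "lyapunov_eq A C (transpose P)"
      by (simp add: lyapunov_eq_def matrix_transpose_mul linear_add[OF linear_transpose]
          linear_0[OF linear_transpose] add.commute)
    then have "transpose P = P" using ex1 P by blast
    moreover have nonneg: "0 \<le> x \<bullet> (P *v x)" for x
    proof (rule tendsto_upperbound[OF mexp_form_tendsto_0[OF stab, of x P x]])
      show "\<forall>\<^sub>F t in at_top. (mexp A t *v x) \<bullet> (P *v (mexp A t *v x)) \<le> x \<bullet> (P *v x)"
        using eventually_ge_at_top[of 0]
      proof eventually_elim
        case (elim t)
        then show ?case using lyapunov_form_mono[OF P elim, of t x] by simp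
      qed
    qed simp
    moreover have "0 < x \<bullet> (P *v x)" if "x \<noteq> 0" for x
      using lyapunov_form_strict_decrease[OF obs P that] nonneg[of "mexp A 1 *v x"] by simp
    ultimately show ?thesis by (simp add: positive_definite_def)
  qed
qed

section \<open>Positivity of the flow\<close>

lemma trace_eq_sum_axis: "trace X = (\<Sum>i\<in>UNIV. axis i 1 \<bullet> (X *v axis i 1))" for X :: "real^'n^'n"
  by (simp add: trace_def matrix_vector_mult_basis column_def inner_axis')

lemma linear_trace: "linear (trace :: real^'n^'n \<Rightarrow> real)"
  by (intro linearI) (simp_all add: trace_def sum.distrib sum_distrib_left)

lemma trace_pos:
  fixes X :: "real^'n^'n"
  assumes "\<And>x. x \<noteq> 0 \<Longrightarrow> 0 < x \<bullet> (X *v x)"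
  shows "0 < trace X"
  unfolding trace_eq_sum_axis by (intro sum_pos assms) auto

lemma trace_nonneg:
  fixes X :: "real^'n^'n"
  assumes "\<And>x. 0 \<le> x \<bullet> (X *v x)"
  shows "0 \<le> trace X"
  unfolding trace_eq_sum_axis by (intro sum_nonneg assms)

lemma flow_solution_combine:
  assumes "flow_solution A C \<alpha> P" "flow_solution A C \<alpha> Q"
  shows "flow_solution A C \<alpha> (\<lambda>t. a *\<^sub>R P t + b *\<^sub>R Q t)"
proof -
  define F where "F = (\<lambda>P. transpose A ** P + P ** A + (\<alpha> * trace P) *\<^sub>R (transpose C ** C))"
  have "linear F"
    unfolding F_def
    by (intro linear_compose_add linear_matrix_mult_left linear_matrix_mult_right
        linear_compose_scale linearI)
       (simp_all add: linear_add[OF linear_trace] linear_scale[OF linear_trace] algebra_simps)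
  then have F: "F (a *\<^sub>R P t + b *\<^sub>R Q t) = a *\<^sub>R F (P t) + b *\<^sub>R F (Q t)" for t
    by (simp only: linear_add linear_scale)
  have flow_iff: "flow_solution A C \<alpha> P
      \<longleftrightarrow> (\<forall>t\<ge>0. (P has_vector_derivative F (P t)) (at t within {0..}))" for P
    by (simp add: flow_solution_def F_def)
  show ?thesis
    using assms unfolding flow_iff F
    by (auto intro!: has_vector_derivative_add
        bounded_linear.has_vector_derivative[OF bounded_linear_scaleR_right])
qed

lemma flow_solution_shift:
  assumes "flow_solution A C \<alpha> P" "0 \<le> r"
  shows "flow_solution A C \<alpha> (\<lambda>t. P (r + t))"
  unfolding flow_solution_def
proof (intro allI impI)
  fix t :: real assume "0 \<le> t"
  let ?D = "transpose A ** P (r + t) + P (r + t) ** A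
      + (\<alpha> * trace (P (r + t))) *\<^sub>R (transpose C ** C)"
  have "(P has_vector_derivative ?D) (at (r + t) within {0..})"
    using assms \<open>0 \<le> t\<close> by (simp add: flow_solution_def)
  then have "(P has_vector_derivative ?D) (at (r + t) within (+) r ` {0..})"
    by (rule has_vector_derivative_within_subset) (use \<open>0 \<le> r\<close> in auto)
  moreover have "((+) r has_vector_derivative 1) (at t within {0..})"
    by (auto intro!: derivative_eq_intros simp flip: has_real_derivative_iff_has_vector_derivative)
  ultimately show "((\<lambda>t. P (r + t)) has_vector_derivative ?D) (at t within {0..})"
    using vector_diff_chain_within[of "(+) r" 1 t "{0..}" P ?D] by (simp add: o_def)
qed

lemma flow_solution_transpose:
  assumes "flow_solution A C \<alpha> P"
  shows "flow_solution A C \<alpha> (\<lambda>t. transpose (P t))"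
  unfolding flow_solution_def
proof (intro allI impI)
  fix t :: real assume "0 \<le> t"
  have tr: "trace (transpose (P t)) = trace (P t)"
    by (simp add: trace_def transpose_def)
  have "((\<lambda>t. transpose (P t)) has_vector_derivative
      transpose (transpose A ** P t + P t ** A + (\<alpha> * trace (P t)) *\<^sub>R (transpose C ** C)))
      (at t within {0..})"
    using assms \<open>0 \<le> t\<close> unfolding flow_solution_def
    by (intro bounded_linear.has_vector_derivative[OF linear_transpose[unfolded linear_conv_bounded_linear]]) auto
  then show "((\<lambda>t. transpose (P t)) has_vector_derivative
      transpose A ** transpose (P t) + transpose (P t) ** A
      + (\<alpha> * trace (transpose (P t))) *\<^sub>R (transpose C ** C)) (at t within {0..})"
    by (simp only: linear_add[OF linear_transpose] linear_scale[OF linear_transpose]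
        matrix_transpose_mul transpose_transpose tr add.commute)
qed

text \<open>The difference \<open>D\<close> of \<open>P\<close> and its transpose solves the flow
  with trace 0. The feedback vanishes, so its bilinear form is carried unchanged from time 0, where
  it is 0.\<close>

lemma flow_solution_symmetric:
  fixes A :: "real^'n^'n"
  assumes flow: "flow_solution A C \<alpha> P" and "transpose (P 0) = P 0" "0 \<le> t"
  shows "transpose (P t) = P t"
proof -
  define D where "D = (\<lambda>t. 1 *\<^sub>R P t + (-1) *\<^sub>R transpose (P t))"
  have D: "flow_solution A C \<alpha> D"
    unfolding D_def by (rule flow_solution_combine[OF flow flow_solution_transpose[OF flow]])
  have tr: "trace (D s) = 0" for s
    by (simp add: D_def trace_def transpose_def)
  have "x \<bullet> (D t *v y) = 0" for x y
  proof -
    let ?h = "\<lambda>s. (mexp A (t - s) *v x) \<bullet> (D s *v (mexp A (t - s) *v y))"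
    have "\<exists>c. \<forall>s\<in>{0..}. ?h s = c"
    proof (rule has_field_derivative_zero_constant)
      show "(?h has_real_derivative 0) (at s within {0..})" if "s \<in> {0..}" for s
        using congruence_has_real_derivative[of D A s 0 C "{0..}"] D that tr
        unfolding flow_solution_def by simp
    qed simp
    then have "?h t = ?h 0" using \<open>0 \<le> t\<close> by (metis atLeast_iff order_refl)
    moreover have "D 0 = 0" using assms(2) by (simp add: D_def)
    ultimately show ?thesis by simp
  qed
  then have "D t *v y = 0" for y by (metis inner_eq_zero_iff)
  then have "D t = 0" by (metis matrix_eq matrix_vector_mult_0)
  then show ?thesis by (simp add: D_def)
qed

locale observable_equilibrium =
  fixes A :: "real^'n^'n" and C :: "real^'n^'m" and \<alpha> :: real and Ps :: "real^'n^'n"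
  assumes obs: "observable A C" and lyap: "lyapunov_eq A C Ps"
    and pd: "positive_definite Ps" and \<alpha>_trace: "\<alpha> * trace Ps = 1"
begin

lemma Ps_pos: "x \<noteq> 0 \<Longrightarrow> 0 < x \<bullet> (Ps *v x)"
  using pd by (simp add: positive_definite_def)

lemma trace_Ps_pos: "0 < trace Ps"
  by (rule trace_pos[OF Ps_pos])

lemma \<alpha>_pos: "0 < \<alpha>"
  using \<alpha>_trace trace_Ps_pos by (metis zero_less_mult_pos2 zero_less_one)

lemma flow_solution_const: "flow_solution A C \<alpha> (\<lambda>t. Ps)"
  using lyap \<alpha>_trace by (simp add: flow_solution_def lyapunov_eq_def)

text \<open>A variation-of-constants bound without integrals: the Lyapunov equation identifies the
  accumulated output energy \<open>|C u|^2\<close> with the drop of the \<open>Ps\<close> form, so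
  subtracting \<beta> times that form leaves a nondecreasing function. The choice \<beta> = 0 gives
  positivity, and \<beta> proportional to \<open>trace (P 0)\<close> gives strong
  positivity.\<close>

lemma flow_form_lower_bound:
  assumes flow: "flow_solution A C \<alpha> P" and "0 \<le> t"
    and \<beta>: "\<And>s. s \<in> {0<..<t} \<Longrightarrow> \<beta> \<le> \<alpha> * trace (P s)"
  shows "(mexp A t *v x) \<bullet> (P 0 *v (mexp A t *v x))
      + \<beta> * (x \<bullet> (Ps *v x) - (mexp A t *v x) \<bullet> (Ps *v (mexp A t *v x))) \<le> x \<bullet> (P t *v x)"
proof -
  let ?u = "\<lambda>s. mexp A (t - s) *v x"
  define h where "h = (\<lambda>s. ?u s \<bullet> (P s *v ?u s) - \<beta> * (?u s \<bullet> (Ps *v ?u s)))"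
  have "h 0 \<le> h t"
  proof (rule mono_of_nonneg_derivative[OF \<open>0 \<le> t\<close>])
    fix s assume s: "s \<in> {0..t}"
    have "(P has_vector_derivative transpose A ** P s + P s ** A
        + (\<alpha> * trace (P s)) *\<^sub>R (transpose C ** C)) (at s within {0..t})"
      using flow s unfolding flow_solution_def
      by (auto intro: has_vector_derivative_within_subset)
    from congruence_has_real_derivative[OF this, of t x x]
      DERIV_cmult[OF constant_congruence[of A Ps 1 C t x x s "{0..t}"], of \<beta>]
    show "(h has_real_derivative (\<alpha> * trace (P s)) * ((C *v ?u s) \<bullet> (C *v ?u s))
        - \<beta> * (1 * ((C *v ?u s) \<bullet> (C *v ?u s)))) (at s within {0..t})"
      unfolding h_def using lyap by (intro DERIV_diff) (simp_all add: lyapunov_eq_def)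
  next
    fix s assume "s \<in> {0<..<t}"
    from mult_right_mono[OF \<beta>[OF this], of "(C *v ?u s) \<bullet> (C *v ?u s)"]
    show "0 \<le> (\<alpha> * trace (P s)) * ((C *v ?u s) \<bullet> (C *v ?u s))
        - \<beta> * (1 * ((C *v ?u s) \<bullet> (C *v ?u s)))"
      by simp
  qed
  then show ?thesis by (simp add: h_def algebra_simps)
qed

text \<open>At the first time with nonpositive trace, all earlier traces are positive, so the forms
  at that time are still positive and so is their sum, the trace. Definite initial data make this
  contradiction strict.\<close>

lemma flow_pos_def:
  assumes flow: "flow_solution A C \<alpha> P" and init: "\<And>x. x \<noteq> 0 \<Longrightarrow> 0 < x \<bullet> (P 0 *v x)"
    and "0 \<le> t" "x \<noteq> 0"
  shows "0 < x \<bullet> (P t *v x)"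
proof -
  \<comment> \<open>Traces are constrained only strictly before \<open>s\<close>, so the claim
    applies at the first bad time itself, including time 0.\<close>
  have pos: "0 < y \<bullet> (P s *v y)"
    if s: "0 \<le> s" "\<And>r. r \<in> {0<..<s} \<Longrightarrow> 0 \<le> trace (P r)" and y: "y \<noteq> 0" for s y
  proof -
    have "0 < (mexp A s *v y) \<bullet> (P 0 *v (mexp A s *v y))"
      using y mexp_apply_eq_0_iff[OF s(1)] by (intro init) auto
    also have "\<dots> \<le> y \<bullet> (P s *v y)"
      using flow_form_lower_bound[OF flow s(1), of 0 y] s(2) \<alpha>_pos by simp
    finally show ?thesis .
  qed
  have "0 < trace (P s)" if "0 \<le> s" for s
  proof (rule ccontr)
    define Z where "Z = {0..s} \<inter> (\<lambda>r. trace (P r)) -` {..0}"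
    assume "\<not> 0 < trace (P s)"
    then have "Z \<noteq> {}" using that by (auto simp: Z_def)
    have "continuous_on {0..} P"
      using flow unfolding flow_solution_def continuous_on_eq_continuous_within
      by (auto intro: has_vector_derivative_continuous)
    then have "continuous_on {0..s} (\<lambda>r. trace (P r))"
      by (intro bounded_linear.continuous_on[OF linear_trace[unfolded linear_conv_bounded_linear]])
         (auto intro: continuous_on_subset)
    then have "closed Z"
      unfolding Z_def by (intro continuous_closed_preimage) auto
    then have "compact Z"
      unfolding compact_eq_bounded_closed Z_def by (auto intro: bounded_subset[of "{0..s}"])
    then obtain r where r: "r \<in> Z" "\<And>q. q \<in> Z \<Longrightarrow> r \<le> q"
      using compact_attains_inf[OF _ \<open>Z \<noteq> {}\<close>] by blast
    have "0 < trace (P r)"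
    proof (rule trace_pos, rule pos)
      show "0 \<le> r" using r(1) by (simp add: Z_def)
      show "0 \<le> trace (P q)" if "q \<in> {0<..<r}" for q
        using r(2)[of q] r(1) that by (force simp: Z_def)
    qed
    with r(1) show False by (simp add: Z_def)
  qed
  then show ?thesis using \<open>x \<noteq> 0\<close> \<open>0 \<le> t\<close> by (intro pos) (auto intro: less_imp_le)
qed

text \<open>Adding \<open>d *\<^sub>R Ps\<close> makes the initial value definite and,
  \<open>Ps\<close> being an equilibrium, changes the form at time \<open>t\<close> by a constant.
  The number \<open>d\<close> is scaled to make this change exactly \<open>e\<close> at the given
  \<open>x\<close>.\<close>

lemma flow_psd:
  assumes flow: "flow_solution A C \<alpha> P" and init: "P 0 \<in> psd_cone" and "0 \<le> t"
  shows "P t \<in> psd_cone"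
proof -
  have "0 \<le> x \<bullet> (P t *v x)" for x
  proof (cases "x = 0")
    case False
    show ?thesis
    proof (rule field_le_epsilon)
      fix e :: real assume "e > 0"
      define d where "d = e / (x \<bullet> (Ps *v x))"
      have "d > 0" using Ps_pos[OF False] \<open>e > 0\<close> by (simp add: d_def)
      have "0 < x \<bullet> ((1 *\<^sub>R P t + d *\<^sub>R Ps) *v x)"
      proof (rule flow_pos_def[OF flow_solution_combine[OF flow flow_solution_const]])
        show "0 < y \<bullet> ((1 *\<^sub>R P 0 + d *\<^sub>R Ps) *v y)" if "y \<noteq> 0" for y
          using init Ps_pos[OF that] \<open>d > 0\<close>
          by (simp add: psd_cone_def matrix_vector_mult_add_rdistrib inner_add_right
              scaleR_matrix_vector_assoc[symmetric] add_nonneg_pos)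
      qed fact+
      also have "\<dots> = x \<bullet> (P t *v x) + e"
        using Ps_pos[OF False]
        by (simp add: d_def matrix_vector_mult_add_rdistrib inner_add_right
              scaleR_matrix_vector_assoc[symmetric])
      finally show "0 \<le> x \<bullet> (P t *v x) + e" by simp
    qed
  qed simp
  then show ?thesis
    using flow_solution_symmetric[OF flow _ \<open>0 \<le> t\<close>] init by (simp add: psd_cone_def)
qed

end

section \<open>Contraction of the Hilbert metric\<close>

lemma form_coercive:
  fixes M :: "real^'n^'n"
  assumes "\<And>x. x \<noteq> 0 \<Longrightarrow> 0 < x \<bullet> (M *v x)"
  obtains c where "0 < c" "\<And>x. c * (x \<bullet> x) \<le> x \<bullet> (M *v x)"
proof -
  have cont: "continuous_on (sphere 0 1) (\<lambda>x. x \<bullet> (M *v x))"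
    by (intro continuous_intros)
  have "axis undefined 1 \<in> (sphere 0 1 :: (real^'n) set)" by simp
  then have "sphere 0 1 \<noteq> ({} :: (real^'n) set)" by (metis empty_iff)
  from continuous_attains_inf[OF compact_sphere this cont]
  obtain y where y: "y \<in> sphere 0 1" "\<And>x. x \<in> sphere 0 1 \<Longrightarrow> y \<bullet> (M *v y) \<le> x \<bullet> (M *v x)"
    by blast
  show ?thesis
  proof
    show "0 < y \<bullet> (M *v y)" using y(1) by (intro assms) auto
    fix x
    show "(y \<bullet> (M *v y)) * (x \<bullet> x) \<le> x \<bullet> (M *v x)"
    proof (cases "x = 0")
      case False
      have "y \<bullet> (M *v y) \<le> (x /\<^sub>R norm x) \<bullet> (M *v (x /\<^sub>R norm x))"
        using False by (intro y(2)) simp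
      also have "\<dots> = (x \<bullet> (M *v x)) / (x \<bullet> x)"
        by (simp add: matrix_vector_mult_scaleR dot_square_norm power2_eq_square field_simps)
      finally show ?thesis using False by (simp add: field_simps)
    qed simp
  qed
qed

text \<open>Testing on the sum and the difference of two basis vectors bounds twice an off-diagonal
  entry by two diagonal ones. The trace thus acts as a linear norm on the cone, and all later
  constants are measured by it.\<close>

lemma psd_cone_entry_bound:
  assumes X: "X \<in> psd_cone"
  shows "\<bar>X $ i $ j\<bar> \<le> trace X"
proof -
  have pos: "0 \<le> x \<bullet> (X *v x)" for x using X by (simp add: psd_cone_def)
  have entry: "axis k 1 \<bullet> (X *v axis l 1) = X $ k $ l" for k l
    by (simp add: matrix_vector_mult_basis column_def inner_axis')
  have diag: "0 \<le> X $ k $ k" for k using pos[of "axis k 1"] by (simp add: entry)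
  have diag_le: "X $ k $ k \<le> trace X" for k
    unfolding trace_def by (rule member_le_sum) (auto intro: diag)
  have sym: "X $ j $ i = X $ i $ j"
    using X by (metis (mono_tags) mem_Collect_eq psd_cone_def transpose_def vec_lambda_beta)
  have "0 \<le> X $ i $ i + X $ j $ j + 2 * (s * X $ i $ j)" if "s * s = 1" for s
  proof -
    have "0 \<le> (axis i 1 + s *\<^sub>R axis j 1) \<bullet> (X *v (axis i 1 + s *\<^sub>R axis j 1))"
      by (rule pos)
    also have "\<dots> = X $ i $ i + s * X $ i $ j + (s * X $ j $ i + (s * s) * X $ j $ j)"
      by (simp add: matrix_vector_right_distrib matrix_vector_mult_scaleR inner_add_left
          inner_add_right entry distrib_left)
    finally show ?thesis unfolding sym that by simp
  qed
  from this[of 1] this[of "-1"] show ?thesis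
    using diag_le[of i] diag_le[of j] by (auto simp: abs_le_iff)
qed

text \<open>The largest eigenvalue is at most the trace, so the sharp factor is 1; the entrywise
  estimate costs the number of entries, which is harmless here.\<close>

lemma psd_cone_form_le_trace:
  fixes X :: "real^'n^'n"
  assumes "X \<in> psd_cone"
  shows "x \<bullet> (X *v x) \<le> (real CARD('n))\<^sup>2 * trace X * (x \<bullet> x)"
proof -
  have "x \<bullet> (X *v x) = (\<Sum>i\<in>UNIV. \<Sum>j\<in>UNIV. x $ i * X $ i $ j * x $ j)"
    by (simp add: inner_vec_def matrix_vector_mult_def sum_distrib_left mult.assoc)
  also have "\<dots> \<le> (\<Sum>i\<in>(UNIV :: 'n set). \<Sum>j\<in>(UNIV :: 'n set). norm x * trace X * norm x)"
  proof (intro sum_mono)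
    fix i j
    have "x $ i * X $ i $ j * x $ j \<le> \<bar>x $ i\<bar> * \<bar>X $ i $ j\<bar> * \<bar>x $ j\<bar>"
      by (metis abs_ge_self abs_mult)
    also have "\<dots> \<le> norm x * trace X * norm x"
      using psd_cone_entry_bound[OF assms, of i j]
      by (intro mult_mono component_le_norm_cart mult_nonneg_nonneg) auto
    finally show "x $ i * X $ i $ j * x $ j \<le> norm x * trace X * norm x" .
  qed
  also have "\<dots> = (real CARD('n))\<^sup>2 * trace X * (x \<bullet> x)"
    by (simp add: dot_square_norm power2_eq_square)
  finally show ?thesis .
qed

lemma psd_cone_trace_pos:
  assumes "X \<in> psd_cone" "X \<noteq> 0"
  shows "0 < trace X"
proof (rule ccontr)
  assume "\<not> 0 < trace X"
  then have "X $ i $ j = 0" for i j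
    using psd_cone_entry_bound[OF assms(1), of i j] by simp
  with assms(2) show False by (simp add: vec_eq_iff)
qed

lemma psd_cone_trace_mult_bound:
  assumes "X \<in> psd_cone"
  shows "- (\<Sum>i\<in>UNIV. \<Sum>j\<in>UNIV. \<bar>A $ j $ i\<bar>) * trace X \<le> trace (X ** A)"
proof -
  have "- (\<Sum>i\<in>UNIV. \<Sum>j\<in>UNIV. \<bar>A $ j $ i\<bar>) * trace X
      = (\<Sum>i\<in>UNIV. \<Sum>j\<in>UNIV. - (trace X * \<bar>A $ j $ i\<bar>))"
    by (simp add: sum_distrib_left sum_negf mult.commute)
  also have "\<dots> \<le> (\<Sum>i\<in>UNIV. \<Sum>j\<in>UNIV. X $ i $ j * A $ j $ i)"
  proof (intro sum_mono)
    fix i j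
    show "- (trace X * \<bar>A $ j $ i\<bar>) \<le> X $ i $ j * A $ j $ i"
      using mult_right_mono[OF psd_cone_entry_bound[OF assms, of i j], of "\<bar>A $ j $ i\<bar>"]
      by (simp add: abs_le_iff flip: abs_mult)
  qed
  also have "\<dots> = trace (X ** A)"
    by (simp add: trace_def matrix_matrix_mult_def)
  finally show ?thesis .
qed

lemma transpose_Gram_trace_nonneg: "0 \<le> trace (transpose C ** C)" for C :: "real^'n^'m"
  by (rule trace_nonneg)
     (simp add: inner_transpose_mult del: transpose_matrix_vector flip: matrix_vector_mul_assoc)

section \<open>Strong positivity of the time-one map\<close>

context observable_equilibrium
begin

text \<open>The feedback only raises the trace, and the remaining term
  \<open>2 * trace (P s ** A)\<close> lowers it at a bounded relative rate. This keeps the feedback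
  comparable with \<open>trace (P 0)\<close> on the unit interval and keeps solutions
  nonzero.\<close>

lemma flow_trace_lower_bound:
  assumes flow: "flow_solution A C \<alpha> P" and init: "P 0 \<in> psd_cone" and "0 \<le> t"
  shows "trace (P 0) * exp (- (2 * (\<Sum>i\<in>UNIV. \<Sum>j\<in>UNIV. \<bar>A $ j $ i\<bar>)) * t) \<le> trace (P t)"
proof -
  let ?K = "\<Sum>i\<in>UNIV. \<Sum>j\<in>UNIV. \<bar>A $ j $ i\<bar>"
  let ?F = "\<lambda>P. transpose A ** P + P ** A + (\<alpha> * trace P) *\<^sub>R (transpose C ** C)"
  have "trace (P 0) * exp (- (2 * ?K) * (t - 0)) \<le> trace (P t)"
  proof (rule exp_decay_lower_bound[OF \<open>0 \<le> t\<close>])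
    fix s assume s: "s \<in> {0..t}"
    have "(P has_vector_derivative ?F (P s)) (at s within {0..t})"
      using flow s unfolding flow_solution_def
      by (auto intro: has_vector_derivative_within_subset)
    then show "((\<lambda>s. trace (P s)) has_real_derivative trace (?F (P s))) (at s within {0..t})"
      unfolding has_real_derivative_iff_has_vector_derivative
      by (rule bounded_linear.has_vector_derivative[OF linear_trace[unfolded linear_conv_bounded_linear]])
    have psd: "P s \<in> psd_cone" using flow_psd[OF flow init] s by simp
    then have "transpose (P s) = P s" by (simp add: psd_cone_def)
    then have "trace (transpose A ** P s) = trace (transpose (P s ** A))"
      by (simp add: matrix_transpose_mul)
    also have "\<dots> = trace (P s ** A)" by (simp add: trace_def transpose_def)
    finally have "trace (?F (P s))
        = 2 * trace (P s ** A) + \<alpha> * trace (P s) * trace (transpose C ** C)"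
      by (simp add: trace_add linear_scale[OF linear_trace])
    moreover have "0 \<le> \<alpha> * trace (P s) * trace (transpose C ** C)"
      using psd \<alpha>_pos
      by (intro mult_nonneg_nonneg transpose_Gram_trace_nonneg trace_nonneg) (auto simp: psd_cone_def)
    ultimately show "- (2 * ?K) * trace (P s) \<le> trace (?F (P s))"
      using psd_cone_trace_mult_bound[OF psd, of A] by simp
  qed
  then show ?thesis by simp
qed

lemma Ps_symmetric: "transpose Ps = Ps"
  using pd by (simp add: positive_definite_def)

lemma Ps_psd: "Ps \<in> psd_cone"
proof -
  have "0 \<le> x \<bullet> (Ps *v x)" for x using Ps_pos[of x] by (cases "x = 0") auto
  then show ?thesis using Ps_symmetric by (simp add: psd_cone_def)
qed

lemma loewner_scaled_le_iff:
  assumes "X \<in> psd_cone"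
  shows "a *\<^sub>R Ps \<preceq> X \<longleftrightarrow> (\<forall>x. a * (x \<bullet> (Ps *v x)) \<le> x \<bullet> (X *v x))"
    and "X \<preceq> a *\<^sub>R Ps \<longleftrightarrow> (\<forall>x. x \<bullet> (X *v x) \<le> a * (x \<bullet> (Ps *v x)))"
  using assms Ps_symmetric
  by (simp_all add: loewner_le_def psd_cone_def linear_diff[OF linear_transpose]
      linear_scale[OF linear_transpose] matrix_vector_mult_diff_rdistrib inner_diff_right
      flip: scaleR_matrix_vector_assoc)

lemma flow_strongly_positive:
  obtains c where "0 < c" "c * trace Ps < 1"
    "\<And>P. flow_solution A C \<alpha> P \<Longrightarrow> P 0 \<in> psd_cone \<Longrightarrow> (c * trace (P 0)) *\<^sub>R Ps \<preceq> P 1"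
proof -
  define K where "K = 2 * (\<Sum>i\<in>UNIV. \<Sum>j\<in>UNIV. \<bar>A $ j $ i\<bar>)"
  have K: "0 \<le> K" by (auto simp: K_def intro!: sum_nonneg)
  define M where "M = Ps - transpose (mexp A 1) ** Ps ** mexp A 1"
  have M: "x \<bullet> (M *v x) = x \<bullet> (Ps *v x) - (mexp A 1 *v x) \<bullet> (Ps *v (mexp A 1 *v x))" for x
    by (simp add: M_def matrix_vector_mult_diff_rdistrib inner_diff_right inner_transpose_mult
        del: transpose_matrix_vector flip: matrix_vector_mul_assoc)
  have "0 < x \<bullet> (M *v x)" if "x \<noteq> 0" for x
    unfolding M using lyapunov_form_strict_decrease[OF obs lyap that] by simp
  then obtain d where d: "0 < d" "\<And>x. d * (x \<bullet> x) \<le> x \<bullet> (M *v x)"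
    using form_coercive by blast
  define u where "u = (real CARD('n))\<^sup>2 * trace Ps"
  have u: "0 < u" using trace_Ps_pos by (simp add: u_def)
  have Vu: "x \<bullet> (Ps *v x) \<le> u * (x \<bullet> x)" for x
    using psd_cone_form_le_trace[OF Ps_psd] by (simp add: u_def)
  \<comment> \<open>The first entry collects the chain \<open>Ps\<close> at most \<open>u I\<close>,
    \<open>d I\<close> at most \<open>M\<close>, feedback at least \<beta>. The second caps
    \<open>c * trace Ps\<close> at one half, so that the contraction factor stays positive and has a
    logarithm.\<close>
  define c where "c = min (\<alpha> * exp (- K) * d / u) (1 / (2 * trace Ps))"
  have "0 < c" using \<alpha>_pos d(1) u trace_Ps_pos by (simp add: c_def)
  have "c * trace Ps \<le> 1 / (2 * trace Ps) * trace Ps"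
    using trace_Ps_pos by (intro mult_right_mono) (auto simp: c_def)
  then have "c * trace Ps < 1" using trace_Ps_pos by simp
  moreover have "(c * trace (P 0)) *\<^sub>R Ps \<preceq> P 1"
    if flow: "flow_solution A C \<alpha> P" and init: "P 0 \<in> psd_cone" for P
  proof -
    have tr0: "0 \<le> trace (P 0)" using init by (intro trace_nonneg) (simp add: psd_cone_def)
    define \<beta> where "\<beta> = \<alpha> * (trace (P 0) * exp (- K))"
    have \<beta>0: "0 \<le> \<beta>" using \<alpha>_pos tr0 by (simp add: \<beta>_def)
    have \<beta>: "\<beta> \<le> \<alpha> * trace (P s)" if "s \<in> {0<..<1}" for s
    proof -
      have "trace (P 0) * exp (- K) \<le> trace (P 0) * exp (- K * s)"
        using that K tr0 by (intro mult_left_mono) (auto simp: mult_left_le)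
      also have "\<dots> \<le> trace (P s)"
        using flow_trace_lower_bound[OF flow init, of s] that by (simp add: K_def)
      finally show ?thesis using \<alpha>_pos by (simp add: \<beta>_def)
    qed
    have "c * trace (P 0) * (x \<bullet> (Ps *v x)) \<le> x \<bullet> (P 1 *v x)" for x
    proof -
      have "c * trace (P 0) * (x \<bullet> (Ps *v x)) \<le> (\<alpha> * exp (- K) * d / u) * trace (P 0) * (u * (x \<bullet> x))"
        using tr0 Vu[of x] Ps_psd u d(1) \<alpha>_pos
        by (intro mult_mono mult_nonneg_nonneg) (auto simp: c_def psd_cone_def)
      also have "\<dots> = \<beta> * (d * (x \<bullet> x))" using u by (simp add: \<beta>_def)
      also have "\<dots> \<le> \<beta> * (x \<bullet> (M *v x))" by (intro mult_left_mono d(2) \<beta>0)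
      also have "\<dots> \<le> x \<bullet> (P 1 *v x)"
        using flow_form_lower_bound[OF flow _ \<beta>, of 1 x] init
        unfolding M psd_cone_def by (smt (verit) mem_Collect_eq)
      finally show ?thesis .
    qed
    then show ?thesis
      using loewner_scaled_le_iff(1)[OF flow_psd[OF flow init]] by simp
  qed
  ultimately show ?thesis using that \<open>0 < c\<close> by blast
qed

text \<open>The upper counterpart of \<open>flow_strongly_positive\<close>: with both bounds
  proportional to the trace, the initial value cancels from their ratio.\<close>

lemma psd_cone_le_trace_scaled:
  obtains c where "0 < c" "\<And>X. X \<in> psd_cone \<Longrightarrow> X \<preceq> (c * trace X) *\<^sub>R Ps"
proof -
  obtain d where d: "0 < d" "\<And>x. d * (x \<bullet> x) \<le> x \<bullet> (Ps *v x)"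
    using form_coercive[OF Ps_pos] by blast
  show ?thesis
  proof
    show "0 < (real CARD('n))\<^sup>2 / d" using d(1) by simp
    fix X :: "real^'n^'n" assume X: "X \<in> psd_cone"
    have tr0: "0 \<le> trace X" using X by (intro trace_nonneg) (simp add: psd_cone_def)
    have "x \<bullet> (X *v x) \<le> (real CARD('n))\<^sup>2 / d * trace X * (x \<bullet> (Ps *v x))" for x
    proof -
      have "x \<bullet> (X *v x) \<le> (real CARD('n))\<^sup>2 / d * trace X * (d * (x \<bullet> x))"
        using psd_cone_form_le_trace[OF X, of x] d(1) by simp
      also have "\<dots> \<le> (real CARD('n))\<^sup>2 / d * trace X * (x \<bullet> (Ps *v x))"
        using d tr0 by (intro mult_left_mono) auto
      finally show ?thesis .
    qed
    then show "X \<preceq> ((real CARD('n))\<^sup>2 / d * trace X) *\<^sub>R Ps"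
      using loewner_scaled_le_iff(2)[OF X] by simp
  qed
qed

lemma flow_solution_minus_scaled:
  assumes "flow_solution A C \<alpha> P"
  shows "flow_solution A C \<alpha> (\<lambda>t. P t - a *\<^sub>R Ps)" "flow_solution A C \<alpha> (\<lambda>t. a *\<^sub>R Ps - P t)"
  using flow_solution_combine[OF assms flow_solution_const, of 1 "- a"]
    flow_solution_combine[OF assms flow_solution_const, of "-1" a] by simp_all

lemma flow_loewner_mono:
  assumes flow: "flow_solution A C \<alpha> P" and "0 \<le> t"
  shows "a *\<^sub>R Ps \<preceq> P 0 \<Longrightarrow> a *\<^sub>R Ps \<preceq> P t" "P 0 \<preceq> a *\<^sub>R Ps \<Longrightarrow> P t \<preceq> a *\<^sub>R Ps"
  using flow_psd[OF flow_solution_minus_scaled(1)[OF flow, of a] _ \<open>0 \<le> t\<close>]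
    flow_psd[OF flow_solution_minus_scaled(2)[OF flow, of a] _ \<open>0 \<le> t\<close>]
  by (simp_all add: loewner_le_def)

lemma flow_nonzero:
  assumes flow: "flow_solution A C \<alpha> P" and init: "P 0 \<in> psd_cone - {0}" and "0 \<le> t"
  shows "P t \<in> psd_cone - {0}"
proof -
  have "0 < trace (P 0) * exp (- (2 * (\<Sum>i\<in>UNIV. \<Sum>j\<in>UNIV. \<bar>A $ j $ i\<bar>)) * t)"
    using init by (intro mult_pos_pos psd_cone_trace_pos) auto
  also have "\<dots> \<le> trace (P t)"
    using flow_trace_lower_bound[OF flow _ \<open>0 \<le> t\<close>] init by simp
  finally have "P t \<noteq> 0" by (auto simp: trace_def)
  then show ?thesis using flow_psd[OF flow _ \<open>0 \<le> t\<close>] init by simp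
qed

section \<open>The distance to \<open>Ps\<close> in terms of order intervals\<close>

lemma scaled_loewner_leD:
  assumes "a *\<^sub>R Ps \<preceq> X" "X \<preceq> b *\<^sub>R Ps"
  shows "a \<le> b"
proof -
  let ?e = "axis undefined 1 :: real^'n"
  have "0 \<le> ?e \<bullet> ((X - a *\<^sub>R Ps) *v ?e) + ?e \<bullet> ((b *\<^sub>R Ps - X) *v ?e)"
    using assms by (intro add_nonneg_nonneg) (simp_all add: loewner_le_def psd_cone_def)
  also have "\<dots> = (b - a) * (?e \<bullet> (Ps *v ?e))"
    by (simp add: matrix_vector_mult_diff_rdistrib inner_diff_right algebra_simps
        flip: scaleR_matrix_vector_assoc)
  finally show ?thesis using Ps_pos[of ?e] by (simp add: zero_le_mult_iff)
qed

lemma hilbert_metric_le: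
  assumes "0 < a" "a *\<^sub>R Ps \<preceq> X" "X \<preceq> b *\<^sub>R Ps"
  shows "hilbert_metric X Ps \<le> ereal (ln (b / a))"
proof -
  \<comment> \<open>The bounds from both sides make the extremal values finite and positive;
    \<open>real_of_ereal\<close> would send an infinite value to 0.\<close>
  have M: "ereal a \<le> hilbert_M X Ps" "hilbert_M X Ps \<le> ereal b"
    using assms scaled_loewner_leD unfolding hilbert_M_def
    by (auto intro!: Inf_greatest Inf_lower)
  then obtain M' where M': "hilbert_M X Ps = ereal M'" by (cases "hilbert_M X Ps") auto
  have m: "ereal a \<le> hilbert_m X Ps" "hilbert_m X Ps \<le> ereal b"
    using assms scaled_loewner_leD unfolding hilbert_m_def
    by (auto intro!: Sup_least Sup_upper)
  then obtain m' where m': "hilbert_m X Ps = ereal m'" by (cases "hilbert_m X Ps") auto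
  have "M' / m' \<le> b / a" "0 < M' / m'"
    using M m M' m' \<open>0 < a\<close> by (auto intro: frac_le)
  then show ?thesis using M' m m' \<open>0 < a\<close> by (simp add: hilbert_metric_def zero_ereal_def)
qed

text \<open>The admissible scalars are cut out by nonstrict inequalities, one ratio of forms for
  each nonzero vector, so the infimum and supremum are attained. The distance is then exactly the
  logarithm of a genuine pair of order bounds.\<close>

lemma hilbert_metric_finiteE:
  assumes X: "X \<in> psd_cone" and fin: "hilbert_metric X Ps \<noteq> \<infinity>"
  obtains a b where "0 < a" "a *\<^sub>R Ps \<preceq> X" "X \<preceq> b *\<^sub>R Ps" "hilbert_metric X Ps = ereal (ln (b / a))"
proof -
  define U L where "U = {\<mu>. X \<preceq> \<mu> *\<^sub>R Ps}" and "L = {\<mu>. \<mu> *\<^sub>R Ps \<preceq> X}"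
  have U_iff: "\<mu> \<in> U \<longleftrightarrow> (\<forall>x. x \<bullet> (X *v x) \<le> \<mu> * (x \<bullet> (Ps *v x)))"
    and L_iff: "\<mu> \<in> L \<longleftrightarrow> (\<forall>x. \<mu> * (x \<bullet> (Ps *v x)) \<le> x \<bullet> (X *v x))" for \<mu>
    using loewner_scaled_le_iff[OF X] by (simp_all add: U_def L_def)
  have M: "hilbert_M X Ps = Inf (ereal ` U)" and m: "hilbert_m X Ps = Sup (ereal ` L)"
    by (simp_all add: hilbert_M_def hilbert_m_def U_def L_def setcompr_eq_image)
  have fin': "hilbert_M X Ps \<noteq> \<infinity>" "hilbert_m X Ps \<noteq> 0"
    using fin by (auto simp: hilbert_metric_def split: if_splits)
  \<comment> \<open>Besides bounding \<open>U\<close> from below, this gives a nonnegative supremum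
    of \<open>L\<close>, so that the condition of being nonzero becomes positivity.\<close>
  have "0 \<in> L" using X by (simp add: L_def loewner_le_def)
  have "U \<noteq> {}" using fin'(1) by (auto simp: M top_ereal_def)
  have LU: "l \<le> r" if "l \<in> L" "r \<in> U" for l r
    using that scaled_loewner_leD by (auto simp: U_def L_def)
  have bddU: "bdd_below U" using LU \<open>0 \<in> L\<close> by (auto simp: bdd_below_def)
  have bddL: "bdd_above L" using LU \<open>U \<noteq> {}\<close> by (fastforce simp: bdd_above_def)
  have Mr: "hilbert_M X Ps = ereal (Inf U)"
    using ereal_Inf'[OF bddU \<open>U \<noteq> {}\<close>] by (simp add: M)
  obtain r where "r \<in> U" using \<open>U \<noteq> {}\<close> by blast
  then have "Sup (ereal ` L) \<le> ereal r" using LU by (auto intro: SUP_least)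
  moreover have "ereal 0 \<le> Sup (ereal ` L)" using \<open>0 \<in> L\<close> by (intro Sup_upper) blast
  ultimately have "\<bar>Sup (ereal ` L)\<bar> \<noteq> \<infinity>" by auto
  then have mr: "hilbert_m X Ps = ereal (Sup L)"
    using ereal_Sup[of L] by (simp add: m)
  have "0 \<le> Sup L" using cSup_upper[OF \<open>0 \<in> L\<close> bddL] .
  with fin'(2) have "0 < Sup L" by (simp add: mr zero_ereal_def)
  moreover have "Inf U \<in> U"
    unfolding U_iff
  proof
    fix x
    show "x \<bullet> (X *v x) \<le> Inf U * (x \<bullet> (Ps *v x))"
    proof (cases "x = 0")
      case False
      have "x \<bullet> (X *v x) / (x \<bullet> (Ps *v x)) \<le> Inf U"
        using \<open>U \<noteq> {}\<close>
        by (rule cInf_greatest)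
           (use Ps_pos[OF False] in \<open>simp add: U_iff field_simps\<close>)
      then show ?thesis using Ps_pos[OF False] by (simp add: field_simps)
    qed simp
  qed
  moreover have "Sup L \<in> L"
    unfolding L_iff
  proof
    fix x
    show "Sup L * (x \<bullet> (Ps *v x)) \<le> x \<bullet> (X *v x)"
    proof (cases "x = 0")
      case False
      have "Sup L \<le> x \<bullet> (X *v x) / (x \<bullet> (Ps *v x))"
      proof (rule cSup_least)
        show "L \<noteq> {}" using \<open>0 \<in> L\<close> by blast
      qed (use Ps_pos[OF False] in \<open>simp add: L_iff field_simps\<close>)
      then show ?thesis using Ps_pos[OF False] by (simp add: field_simps)
    qed simp
  qed
  ultimately show ?thesis
    using fin' by (intro that[of "Sup L" "Inf U"])
      (auto simp: U_def L_def hilbert_metric_def Mr mr)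
qed

text \<open>Each end moves inwards by \<open>c\<close> times the trace of its own gap. The bound
  \<open>a \<le> a'\<close> is kept because the lower end later serves as a denominator.\<close>

lemma flow_oscillation_contraction:
  obtains r where "0 < r" "r < 1"
    "\<And>P a b. flow_solution A C \<alpha> P \<Longrightarrow> a *\<^sub>R Ps \<preceq> P 0 \<Longrightarrow> P 0 \<preceq> b *\<^sub>R Ps \<Longrightarrow>
      \<exists>a' b'. a \<le> a' \<and> b' - a' \<le> r * (b - a) \<and> a' *\<^sub>R Ps \<preceq> P 1 \<and> P 1 \<preceq> b' *\<^sub>R Ps"
proof -
  obtain c where c: "0 < c" "c * trace Ps < 1"
    "\<And>P. flow_solution A C \<alpha> P \<Longrightarrow> P 0 \<in> psd_cone \<Longrightarrow> (c * trace (P 0)) *\<^sub>R Ps \<preceq> P 1"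
    using flow_strongly_positive by blast
  show ?thesis
  proof (rule that[of "1 - c * trace Ps"])
    fix P a b assume flow: "flow_solution A C \<alpha> P" and ab: "a *\<^sub>R Ps \<preceq> P 0" "P 0 \<preceq> b *\<^sub>R Ps"
    define a' b' where "a' = a + c * trace (P 0 - a *\<^sub>R Ps)" and "b' = b - c * trace (b *\<^sub>R Ps - P 0)"
    have psd: "P 0 - a *\<^sub>R Ps \<in> psd_cone" "b *\<^sub>R Ps - P 0 \<in> psd_cone"
      using ab by (simp_all add: loewner_le_def)
    have "(c * trace (P 0 - a *\<^sub>R Ps)) *\<^sub>R Ps \<preceq> P 1 - a *\<^sub>R Ps"
      "(c * trace (b *\<^sub>R Ps - P 0)) *\<^sub>R Ps \<preceq> b *\<^sub>R Ps - P 1"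
      using c(3)[OF flow_solution_minus_scaled(1)[OF flow] psd(1)]
        c(3)[OF flow_solution_minus_scaled(2)[OF flow] psd(2)] by simp_all
    then have "a' *\<^sub>R Ps \<preceq> P 1" "P 1 \<preceq> b' *\<^sub>R Ps"
      by (simp_all add: loewner_le_def a'_def b'_def scaleR_add_left scaleR_diff_left algebra_simps)
    moreover have "a \<le> a'"
      using psd(1) c(1) by (simp add: a'_def trace_nonneg psd_cone_def)
    moreover have "b' - a' = (1 - c * trace Ps) * (b - a)"
      by (simp add: a'_def b'_def linear_diff[OF linear_trace] linear_scale[OF linear_trace] algebra_simps)
    ultimately show "\<exists>a' b'. a \<le> a' \<and> b' - a' \<le> (1 - c * trace Ps) * (b - a)
        \<and> a' *\<^sub>R Ps \<preceq> P 1 \<and> P 1 \<preceq> b' *\<^sub>R Ps"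
      by (metis order_refl)
  qed (use c trace_Ps_pos in auto)
qed

text \<open>Widths contract linearly, logarithms do not; \<open>ln y \<le> y - 1\<close> passes from
  one to the other, and \<open>(b' - a') / a'\<close> is controlled because the lower end never
  decreases. The rate is minus the logarithm of the contraction factor.\<close>

lemma flow_hilbert_decay:
  obtains \<gamma> where "0 < \<gamma>"
    "\<And>P a b t. flow_solution A C \<alpha> P \<Longrightarrow> 0 < a \<Longrightarrow> a *\<^sub>R Ps \<preceq> P 0 \<Longrightarrow> P 0 \<preceq> b *\<^sub>R Ps \<Longrightarrow> 0 \<le> t \<Longrightarrow>
      hilbert_metric (P t) Ps \<le> ereal (exp (- \<gamma> * (t - 1)) * ((b - a) / a))"
proof -
  obtain r where r: "0 < r" "r < 1"
    "\<And>P a b. flow_solution A C \<alpha> P \<Longrightarrow> a *\<^sub>R Ps \<preceq> P 0 \<Longrightarrow> P 0 \<preceq> b *\<^sub>R Ps \<Longrightarrow>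
      \<exists>a' b'. a \<le> a' \<and> b' - a' \<le> r * (b - a) \<and> a' *\<^sub>R Ps \<preceq> P 1 \<and> P 1 \<preceq> b' *\<^sub>R Ps"
    using flow_oscillation_contraction by blast
  show ?thesis
  proof (rule that[of "- ln r"])
    show "0 < - ln r" using r by simp
    fix P a b and t :: real
    assume flow: "flow_solution A C \<alpha> P" and a: "0 < a" and ab: "a *\<^sub>R Ps \<preceq> P 0" "P 0 \<preceq> b *\<^sub>R Ps"
      and t: "0 \<le> t"
    have ab_le: "a \<le> b" by (rule scaled_loewner_leD[OF ab])
    have iter: "\<exists>a' b'. a \<le> a' \<and> b' - a' \<le> r ^ n * (b - a)
        \<and> a' *\<^sub>R Ps \<preceq> P (real n) \<and> P (real n) \<preceq> b' *\<^sub>R Ps" for n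
    proof (induction n)
      case 0
      show ?case using ab by (intro exI[of _ a] exI[of _ b]) simp
    next
      case (Suc n)
      then obtain a' b' where 1: "a \<le> a'" "b' - a' \<le> r ^ n * (b - a)"
        "a' *\<^sub>R Ps \<preceq> P (real n)" "P (real n) \<preceq> b' *\<^sub>R Ps" by blast
      obtain a'' b'' where 2: "a' \<le> a''" "b'' - a'' \<le> r * (b' - a')"
        "a'' *\<^sub>R Ps \<preceq> P (real n + 1)" "P (real n + 1) \<preceq> b'' *\<^sub>R Ps"
        using r(3)[OF flow_solution_shift[OF flow, of "real n"], of a' b'] 1 by auto
      have "r * (b' - a') \<le> r ^ Suc n * (b - a)"
        using 1(2) r(1) by simp
      with 1 2 show ?case by (intro exI[of _ a''] exI[of _ b'']) (auto simp: add.commute)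
    qed
    \<comment> \<open>Contraction is available only at integer times; from \<open>n\<close> to
      \<open>t\<close> the interval is merely preserved. Rounding down loses less than one unit,
      hence \<open>t - 1\<close> in the exponent.\<close>
    define n where "n = nat \<lfloor>t\<rfloor>"
    have n: "real n \<le> t" "t - 1 \<le> real n" using t by (simp_all add: n_def)
    obtain a' b' where 1: "a \<le> a'" "b' - a' \<le> r ^ n * (b - a)"
        "a' *\<^sub>R Ps \<preceq> P (real n)" "P (real n) \<preceq> b' *\<^sub>R Ps" using iter by blast
    have 2: "a' *\<^sub>R Ps \<preceq> P t" "P t \<preceq> b' *\<^sub>R Ps"
      using flow_loewner_mono[OF flow_solution_shift[OF flow, of "real n"], of "t - real n"] 1 n by auto
    have a': "0 < a'" "a' \<le> b'" using a 1 scaled_loewner_leD[OF 2] by auto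
    have "ln (b' / a') \<le> b' / a' - 1" using a' by (intro ln_le_minus_one) simp
    also have "\<dots> = (b' - a') / a'" using a' by (simp add: diff_divide_distrib)
    also have "\<dots> \<le> (r ^ n * (b - a)) / a"
      using 1 a a' ab_le r by (intro frac_le) auto
    also have "\<dots> = r ^ n * ((b - a) / a)" by simp
    also have "\<dots> \<le> exp (- (- ln r) * (t - 1)) * ((b - a) / a)"
    proof (rule mult_right_mono)
      have "r ^ n = exp (real n * ln r)"
        using r(1) by (simp add: exp_of_nat_mult)
      also have "\<dots> \<le> exp (- (- ln r) * (t - 1))"
        using n(2) r by (simp add: mult.commute mult_left_mono_neg)
      finally show "r ^ n \<le> exp (- (- ln r) * (t - 1))" .
    qed (use a ab_le in simp)
    finally show "hilbert_metric (P t) Ps \<le> ereal (exp (- (- ln r) * (t - 1)) * ((b - a) / a))"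
      using order_trans[OF hilbert_metric_le[OF a'(1) 2]] by simp
  qed
qed

text \<open>For \<open>t \<le> 1\<close> monotonicity of the flow suffices. At \<open>t = 1\<close> the ratio \<open>b / a\<close> is at most a constant
  \<open>R\<close> independent of the initial value, so that \<open>(b - a) / a\<close> is comparable with \<open>ln (b / a)\<close> from
  then on.\<close>

lemma flow_hilbert_contraction:
  obtains k \<gamma> where "0 < k" "0 < \<gamma>"
    "\<And>P t. flow_solution A C \<alpha> P \<Longrightarrow> P 0 \<in> psd_cone - {0} \<Longrightarrow> 0 \<le> t \<Longrightarrow>
      hilbert_metric (P t) Ps \<le> ereal (k * exp (- \<gamma> * t)) * hilbert_metric (P 0) Ps"
proof -
  obtain \<gamma> where \<gamma>: "0 < \<gamma>"
    "\<And>P a b t. flow_solution A C \<alpha> P \<Longrightarrow> 0 < a \<Longrightarrow> a *\<^sub>R Ps \<preceq> P 0 \<Longrightarrow> P 0 \<preceq> b *\<^sub>R Ps \<Longrightarrow> 0 \<le> t \<Longrightarrow>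
      hilbert_metric (P t) Ps \<le> ereal (exp (- \<gamma> * (t - 1)) * ((b - a) / a))"
    using flow_hilbert_decay by blast
  obtain c1 where c1: "0 < c1"
    "\<And>P. flow_solution A C \<alpha> P \<Longrightarrow> P 0 \<in> psd_cone \<Longrightarrow> (c1 * trace (P 0)) *\<^sub>R Ps \<preceq> P 1"
    using flow_strongly_positive by blast
  obtain c2 where c2: "0 < c2" "\<And>X. X \<in> psd_cone \<Longrightarrow> X \<preceq> (c2 * trace X) *\<^sub>R Ps"
    using psd_cone_le_trace_scaled by blast
  \<comment> \<open>At time 1 the solution lies between \<open>c1 * trace (P 0)\<close> and
    \<open>c2 * trace (P 0)\<close> times \<open>Ps\<close>: strong positivity gives the lower
    bound, and monotonicity carries the upper bound over from time 0.\<close>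
  define R where "R = c2 / c1"
  have R: "0 < R" using c1 c2 by (simp add: R_def)
  \<comment> \<open>The summands \<open>R\<close> and 1 serve the times after and up to 1. The
    factor \<open>exp (2 * \<gamma>)\<close> pays for restarting at time 1 and for rounding down to
    an integer time.\<close>
  define k where "k = exp (2 * \<gamma>) * (R + 1)"
  show ?thesis
  proof (rule that[of k \<gamma>])
    show k: "0 < k" using R by (simp add: k_def)
    fix P and t :: real
    assume flow: "flow_solution A C \<alpha> P" and init: "P 0 \<in> psd_cone - {0}" and t: "0 \<le> t"
    show "hilbert_metric (P t) Ps \<le> ereal (k * exp (- \<gamma> * t)) * hilbert_metric (P 0) Ps"
    proof (cases "hilbert_metric (P 0) Ps = \<infinity>")
      case True
      then show ?thesis using k by simp
    next
      case False
      then obtain a b where ab: "0 < a" "a *\<^sub>R Ps \<preceq> P 0" "P 0 \<preceq> b *\<^sub>R Ps"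
        and d0: "hilbert_metric (P 0) Ps = ereal (ln (b / a))"
        using hilbert_metric_finiteE init by (metis DiffD1)
      have "a \<le> b" by (rule scaled_loewner_leD[OF ab(2,3)])
      then have ln0: "0 \<le> ln (b / a)" using ab(1) by simp
      have mono: "hilbert_metric (P s) Ps \<le> ereal (ln (b / a))" if "0 \<le> s" for s
        using flow_loewner_mono[OF flow that] ab by (intro hilbert_metric_le) auto
      have "\<exists>q. hilbert_metric (P t) Ps \<le> ereal (q * ln (b / a)) \<and> q \<le> k * exp (- \<gamma> * t)"
      proof (cases "t \<le> 1")
        case True
        have "1 \<le> exp (2 * \<gamma>) * exp (- \<gamma> * t)"
          using True \<gamma>(1) t by (simp flip: exp_add)
        also have "\<dots> \<le> k * exp (- \<gamma> * t)" using R by (simp add: k_def)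
        finally show ?thesis using mono[OF t] by (intro exI[of _ 1]) simp
      next
        case False
        have tr: "0 < trace (P 0)" using init by (intro psd_cone_trace_pos) auto
        have "hilbert_metric (P 1) Ps \<le> ereal (ln ((c2 * trace (P 0)) / (c1 * trace (P 0))))"
          using flow_loewner_mono(2)[OF flow, of 1] c1 c2 flow init tr
          by (intro hilbert_metric_le) auto
        then have lnR: "hilbert_metric (P 1) Ps \<le> ereal (ln R)"
          using tr by (simp add: R_def)
        then have "hilbert_metric (P 1) Ps \<noteq> \<infinity>" by auto
        then obtain a' b' where ab': "0 < a'" "a' *\<^sub>R Ps \<preceq> P 1" "P 1 \<preceq> b' *\<^sub>R Ps"
          and d1: "hilbert_metric (P 1) Ps = ereal (ln (b' / a'))"
          using hilbert_metric_finiteE[of "P 1"] flow_nonzero[OF flow init, of 1] by auto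
        define y where "y = b' / a'"
        have y: "1 \<le> y" using scaled_loewner_leD[OF ab'(2,3)] ab'(1) by (simp add: y_def)
        have "y \<le> R" using lnR d1 y R by (simp add: y_def[symmetric])
        have lny: "0 \<le> ln y" "ln y \<le> ln (b / a)"
          using mono[of 1] d1 y by (simp_all add: y_def[symmetric])
        \<comment> \<open>The logarithm inequality at \<open>1 / y\<close> gives the reverse
          comparison \<open>y - 1 \<le> y * ln y\<close>. Bounding the factor \<open>y\<close> by
          \<open>R\<close> makes it linear in the distance at time 1, which is at most the initial
          one.\<close>
        have "ln (1 / y) \<le> 1 / y - 1" using y by (intro ln_le_minus_one) simp
        then have "y - 1 \<le> y * ln y" using y by (simp add: ln_div field_simps)
        also have "\<dots> \<le> R * ln (b / a)"
          using \<open>y \<le> R\<close> lny R by (intro mult_mono) auto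
        finally have "(b' - a') / a' \<le> R * ln (b / a)"
          using ab'(1) by (simp add: y_def diff_divide_distrib)
        then have le: "exp (- \<gamma> * (t - 1 - 1)) * ((b' - a') / a') \<le> exp (- \<gamma> * (t - 1 - 1)) * (R * ln (b / a))"
          by (intro mult_left_mono) auto
        have "hilbert_metric (P (1 + (t - 1))) Ps \<le> ereal (exp (- \<gamma> * (t - 1 - 1)) * ((b' - a') / a'))"
          by (rule \<gamma>(2)[OF flow_solution_shift[OF flow, of 1]]) (use ab' False in auto)
        also have "\<dots> \<le> ereal (exp (- \<gamma> * (t - 1 - 1)) * R * ln (b / a))"
          using le by (simp add: mult.assoc)
        finally have "hilbert_metric (P t) Ps \<le> ereal (exp (- \<gamma> * (t - 1 - 1)) * R * ln (b / a))"
          by simp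
        moreover have "exp (- \<gamma> * (t - 1 - 1)) = exp (2 * \<gamma>) * exp (- \<gamma> * t)"
          by (simp add: algebra_simps flip: exp_add)
        ultimately show ?thesis
          by (intro exI[of _ "exp (- \<gamma> * (t - 1 - 1)) * R"]) (simp add: k_def)
      qed
      then obtain q where q: "hilbert_metric (P t) Ps \<le> ereal (q * ln (b / a))"
        "q \<le> k * exp (- \<gamma> * t)" by blast
      then show ?thesis
        using mult_right_mono[OF q(2) ln0] unfolding d0 times_ereal.simps
        by (meson ereal_less_eq(3) order_trans)
    qed
  qed (rule \<gamma>(1))
qed

end

text \<open>The constants are chosen before \<open>P\<close> and \<open>P0\<close>, so they are
  uniform over all solutions. Membership of \<open>P t\<close> in the punctured cone is part of the
  conclusion because \<open>hilbert_metric\<close> is meaningful only there.\<close>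

theorem mainTheorem5:
  fixes A :: "real^'n^'n" and C :: "real^'n^'m"
  assumes "stable_matrix A" and "observable A C"
  shows "(\<exists>!Ps. positive_definite Ps \<and> lyapunov_eq A C Ps) \<and>
    (\<forall>Ps. positive_definite Ps \<and> lyapunov_eq A C Ps \<longrightarrow>
      (\<exists>\<alpha>>0. \<exists>k>0. \<exists>\<gamma>>0. \<forall>P P0.
         P0 \<in> psd_cone - {0} \<and> P 0 = P0 \<and> flow_solution A C \<alpha> P \<longrightarrow>
         (\<forall>t\<ge>0. P t \<in> psd_cone - {0} \<and>
            hilbert_metric (P t) Ps \<le> ereal (k * exp (- \<gamma> * t)) * hilbert_metric P0 Ps)))"
proof (intro conjI allI impI)
  show "\<exists>!Ps. positive_definite Ps \<and> lyapunov_eq A C Ps"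
    using lyapunov_solution[OF assms] by blast
next
  fix Ps assume Ps: "positive_definite Ps \<and> lyapunov_eq A C Ps"
  then have "0 < trace Ps"
    by (intro trace_pos) (simp add: positive_definite_def)
  then interpret observable_equilibrium A C "1 / trace Ps" Ps
    using assms(2) Ps by unfold_locales auto
  obtain k \<gamma> where "0 < k" "0 < \<gamma>"
    "\<And>P t. flow_solution A C (1 / trace Ps) P \<Longrightarrow> P 0 \<in> psd_cone - {0} \<Longrightarrow> 0 \<le> t \<Longrightarrow>
      hilbert_metric (P t) Ps \<le> ereal (k * exp (- \<gamma> * t)) * hilbert_metric (P 0) Ps"
    using flow_hilbert_contraction by blast
  then show "\<exists>\<alpha>>0. \<exists>k>0. \<exists>\<gamma>>0. \<forall>P P0.
         P0 \<in> psd_cone - {0} \<and> P 0 = P0 \<and> flow_solution A C \<alpha> P \<longrightarrow>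
         (\<forall>t\<ge>0. P t \<in> psd_cone - {0} \<and>
            hilbert_metric (P t) Ps \<le> ereal (k * exp (- \<gamma> * t)) * hilbert_metric P0 Ps)"
    using flow_nonzero \<alpha>_pos by blast
qed

end
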